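(* There exist absolute constants $C>0$ and $c>0$ such that the following holds. Let $S_1$ and $S_2$ be two collections of bi-infinite $x$-monotone curves such that $S_1\cup S_2$ is in general position, with $|S_1|=|S_2|=n$, and suppose that the number of touching pairs $(s_1,s_2)$ with $s_1\in S_1$, $s_2\in S_2$ is $tn$, where $t>C$. Then the number of crossing points between pairs of elements of $S_1$, or the number of crossing points between pairs of elements of $S_2$, is at least $c\, nt\sqrt{\log t/\log\log t}$.
   Context: A bi-infinite $x$-monotone curve is the graph of a continuous function $f:\mathbb{R}\to\mathbb{R}$. A family of curves is in general position if no three curves pass through the same point and no two curves share infinitely many points. Two curves touch if they have precisely one point in common, at which they do not properly cross; this point is a touching point. All other common points of two curves are crossing points. *)

theory Defs
  imports "HOL-Analysis.Analysis"
begin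

definition fun_graph :: "(real \<Rightarrow> real) \<Rightarrow> (real \<times> real) set" where
  "fun_graph f = {(x, f x) | x. True}"

definition bi_infinite_x_monotone_curve :: "(real \<times> real) set \<Rightarrow> bool" where
  "bi_infinite_x_monotone_curve s \<longleftrightarrow> (\<exists>f. continuous_on UNIV f \<and> s = fun_graph f)"

definition general_position :: "(real \<times> real) set set \<Rightarrow> bool" where
  "general_position S \<longleftrightarrow>
     (\<forall>s1\<in>S. \<forall>s2\<in>S. \<forall>s3\<in>S. s1 \<noteq> s2 \<and> s1 \<noteq> s3 \<and> s2 \<noteq> s3 \<longrightarrow> s1 \<inter> s2 \<inter> s3 = {}) \<and>
     (\<forall>s1\<in>S. \<forall>s2\<in>S. s1 \<noteq> s2 \<longrightarrow> finite (s1 \<inter> s2))"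

text \<open>
  The curves swap their vertical order at the common point. The functions are determined by the
  curves, so the existential quantifier only names them. The notion is intended for isolated common
  points, near which the order is constant on either side; in general position all common points
  are isolated.
\<close>

definition properly_cross_at ::
    "(real \<times> real) set \<Rightarrow> (real \<times> real) set \<Rightarrow> real \<times> real \<Rightarrow> bool" where
  "properly_cross_at s1 s2 p \<longleftrightarrow>
     p \<in> s1 \<inter> s2 \<and>
     (\<exists>f g. s1 = fun_graph f \<and> s2 = fun_graph g \<and>
        ((\<forall>\<^sub>F x in at_left (fst p). f x < g x) \<and> (\<forall>\<^sub>F x in at_right (fst p). g x < f x) \<or>
         (\<forall>\<^sub>F x in at_left (fst p). g x < f x) \<and> (\<forall>\<^sub>F x in at_right (fst p). f x < g x)))"

definition touching_point ::
    "(real \<times> real) set \<Rightarrow> (real \<times> real) set \<Rightarrow> real \<times> real \<Rightarrow> bool" where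
  "touching_point s1 s2 p \<longleftrightarrow> s1 \<inter> s2 = {p} \<and> \<not> properly_cross_at s1 s2 p"

definition touch :: "(real \<times> real) set \<Rightarrow> (real \<times> real) set \<Rightarrow> bool" where
  "touch s1 s2 \<longleftrightarrow> (\<exists>p. touching_point s1 s2 p)"

text \<open>
  Every common point other than a touching point is a crossing point; in particular, a point of
  tangency of two curves that also meet elsewhere counts as a crossing point.
\<close>

definition crossing_point ::
    "(real \<times> real) set \<Rightarrow> (real \<times> real) set \<Rightarrow> real \<times> real \<Rightarrow> bool" where
  "crossing_point s1 s2 p \<longleftrightarrow> p \<in> s1 \<inter> s2 \<and> \<not> touching_point s1 s2 p"

definition touching_pairs ::
    "(real \<times> real) set set \<Rightarrow> (real \<times> real) set set \<Rightarrow>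
     ((real \<times> real) set \<times> (real \<times> real) set) set" where
  "touching_pairs S1 S2 = {(s1, s2). s1 \<in> S1 \<and> s2 \<in> S2 \<and> touch s1 s2}"

text \<open>
  In general position a point lies on at most two curves, so counting points of this set is the
  same as adding up the crossing points over all unordered pairs.
\<close>

definition crossing_points :: "(real \<times> real) set set \<Rightarrow> (real \<times> real) set" where
  "crossing_points S = {p. \<exists>s1\<in>S. \<exists>s2\<in>S. s1 \<noteq> s2 \<and> crossing_point s1 s2 p}"

end

theory Submission
  imports Defs "HOL-Real_Asymp.Real_Asymp"
begin

text \<open>
  Two touching graphs are ordered, so after possibly swapping the two families at least half of the
  touching pairs \<open>(f, g)\<close> have \<open>f\<close> below \<open>g\<close>; call them edges and let the time \<open>T f g\<close> be the
  abscissa of the touching point. If \<open>f\<close> and \<open>z\<close> both touch \<open>g\<close> from below, then \<open>f\<close> is above \<open>z\<close>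
  at time \<open>T f g\<close>. Hence, listing in order of time the edges of \<open>f\<close> and of \<open>z\<close> to their common
  neighbours, every change from an \<open>f\<close>-edge to a \<open>z\<close>-edge forces a crossing of its own, and it
  suffices to bound from below the number of runs of consecutive \<open>f\<close>-edges in these words (over all
  pairs \<open>f, z\<close> below, and likewise all pairs above).

  Suppose there are at most \<open>s\<close> runs per edge, and take about \<open>s\<^sup>2\<close> scales that are powers of a
  fixed multiple of \<open>s\<^sup>3\<close>. Some scale contains few runs of medium length. Fix \<open>\<rho>\<close> inside that scale,
  take a typical edge \<open>(f, g)\<close>, and assume that its first \<open>\<rho>\<close> successors \<open>(z, g)\<close> come before the
  \<open>\<rho>\<close>-th successor in row \<open>f\<close>. An edge \<open>(f, h)\<close> with \<open>h\<close> a neighbour of \<open>z\<close> and with time between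
  \<open>(f, g)\<close> and \<open>(z, g)\<close> lies in a run of \<open>h\<close> against \<open>g\<close> that is confined to this time interval. If
  that run were long, then too many rows \<open>w\<close> would interrupt \<open>f\<close> within \<open>\<rho>\<close> edges; runs that are
  not long are rare, so for each of the \<open>\<rho>\<close> rows \<open>z\<close> the run of \<open>f\<close> against \<open>z\<close> ends within very
  few edges. That is again too many run ends for a typical edge.
\<close>

section \<open>Runs in edge-ordered bipartite graphs\<close>

definition next_set :: "('a \<times> 'b) set \<Rightarrow> ('a \<Rightarrow> 'b \<Rightarrow> real) \<Rightarrow> 'a \<Rightarrow> 'b \<Rightarrow> 'a \<Rightarrow> 'b set" where
  "next_set E T f g z = {h. (f, h) \<in> E \<and> (z, h) \<in> E \<and> T f g < T z h}"

definition next_time :: "('a \<times> 'b) set \<Rightarrow> ('a \<Rightarrow> 'b \<Rightarrow> real) \<Rightarrow> 'a \<Rightarrow> 'b \<Rightarrow> 'a \<Rightarrow> real" where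
  "next_time E T f g z = Min (T z ` next_set E T f g z)"

text \<open>\<open>Min\<close> of an empty set is unspecified, so triples with empty
  \<open>next_set\<close> are left out. For finite \<open>E\<close>, \<open>next_time\<close> is
  then a genuine time of a \<open>z\<close>-edge on every live triple.\<close>

definition live :: "('a \<times> 'b) set \<Rightarrow> ('a \<Rightarrow> 'b \<Rightarrow> real) \<Rightarrow> ('a \<times> 'b \<times> 'a) set" where
  "live E T = {(f, g, z). (f, g) \<in> E \<and> (z, g) \<in> E \<and> f \<noteq> z \<and> next_set E T f g z \<noteq> {}}"

text \<open>
  A run of \<open>f\<close> against \<open>z\<close> is identified by the time of the \<open>z\<close>-edge that ends it. A final run, which
  no \<open>z\<close>-edge follows, is deliberately not counted: it need not be followed by a crossing.
\<close>

definition run_id :: "('a \<times> 'b) set \<Rightarrow> ('a \<Rightarrow> 'b \<Rightarrow> real) \<Rightarrow> 'a \<times> 'b \<times> 'a \<Rightarrow> 'a \<times> 'a \<times> real" where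
  "run_id E T = (\<lambda>(f, g, z). (f, z, next_time E T f g z))"

definition runs :: "('a \<times> 'b) set \<Rightarrow> ('a \<Rightarrow> 'b \<Rightarrow> real) \<Rightarrow> ('a \<times> 'a \<times> real) set" where
  "runs E T = run_id E T ` live E T"

definition run_length :: "('a \<times> 'b) set \<Rightarrow> ('a \<Rightarrow> 'b \<Rightarrow> real) \<Rightarrow> 'a \<times> 'a \<times> real \<Rightarrow> nat" where
  "run_length E T i = card {x \<in> live E T. run_id E T x = i}"

definition forward :: "('a \<times> 'b) set \<Rightarrow> ('a \<Rightarrow> 'b \<Rightarrow> real) \<Rightarrow> 'a \<Rightarrow> 'b \<Rightarrow> 'a \<Rightarrow> nat" where
  "forward E T f g z =
     card {h. (f, h) \<in> E \<and> (z, h) \<in> E \<and> T f g \<le> T f h \<and> T f h < next_time E T f g z}"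

text \<open>Edges that share a vertex or are opposite in a 4-cycle never have the same time.\<close>

definition separated :: "('a \<times> 'b) set \<Rightarrow> ('a \<Rightarrow> 'b \<Rightarrow> real) \<Rightarrow> bool" where
  "separated E T \<longleftrightarrow> (\<forall>f g f' g'. (f, g) \<in> E \<longrightarrow> (f', g') \<in> E \<longrightarrow> (f, g') \<in> E \<longrightarrow> (f', g) \<in> E \<longrightarrow>
     (f, g) \<noteq> (f', g') \<longrightarrow> T f g \<noteq> T f' g')"

abbreviation (input) flip :: "('a \<Rightarrow> 'b \<Rightarrow> 'c) \<Rightarrow> 'b \<Rightarrow> 'a \<Rightarrow> 'c" where
  "flip T \<equiv> (\<lambda>b a. T a b)"

section \<open>Next times and counting by fibres\<close>

lemma separatedD:
  "\<lbrakk>separated E T; T f g = T f' g'; (f, g) \<in> E; (f', g') \<in> E; (f, g') \<in> E; (f', g) \<in> E\<rbrakk>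
    \<Longrightarrow> f = f' \<and> g = g'"
  unfolding separated_def by blast

lemma separated_converse: "separated E T \<Longrightarrow> separated (E\<inverse>) (flip T)"
  by (subst separated_def) (metis separatedD converse_iff)

lemma finite_row: "finite E \<Longrightarrow> finite {h. (f, h) \<in> E \<and> P h}"
  by (rule finite_subset[of _ "snd ` E"]) force+

lemma finite_next_set: "finite E \<Longrightarrow> finite (next_set E T f g z)"
  unfolding next_set_def by (rule finite_row)

lemma finite_live: "finite E \<Longrightarrow> finite (live E T)"
proof -
  assume "finite E"
  then have "finite (fst ` E \<times> snd ` E \<times> fst ` E)" by blast
  moreover have "live E T \<subseteq> fst ` E \<times> snd ` E \<times> fst ` E"
    unfolding live_def by force
  ultimately show ?thesis by (rule finite_subset[rotated])
qed

lemma next_time_le: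
  assumes "finite E" "h \<in> next_set E T f g z"
  shows "next_time E T f g z \<le> T z h"
  unfolding next_time_def using assms finite_next_set[OF assms(1)] by (intro Min_le) auto

lemma next_time_attained:
  assumes "finite E" "next_set E T f g z \<noteq> {}"
  obtains h where "h \<in> next_set E T f g z" "next_time E T f g z = T z h"
proof -
  have "next_time E T f g z \<in> T z ` next_set E T f g z"
    unfolding next_time_def using assms finite_next_set[OF assms(1)] by (intro Min_in) auto
  then show thesis using that by auto
qed

lemma next_time_greater:
  assumes "finite E" "(f, g, z) \<in> live E T"
  shows "T f g < next_time E T f g z"
proof -
  have "next_set E T f g z \<noteq> {}" using assms(2) by (simp add: live_def)
  then obtain h where "h \<in> next_set E T f g z" "next_time E T f g z = T z h"
    using next_time_attained[OF assms(1)] by blast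
  then show ?thesis by (simp add: next_set_def)
qed

lemma card_le_by_fibres:
  assumes "finite A" "\<And>y. y \<in> f ` A \<Longrightarrow> card {x \<in> A. f x = y} \<le> k y"
  shows "card A \<le> (\<Sum>y\<in>f ` A. k y)"
proof -
  have "card A = (\<Sum>y\<in>f ` A. card {x \<in> A. f x = y})"
    using sum.image_gen[OF assms(1), of "\<lambda>_. 1::nat" f] by simp
  also have "\<dots> \<le> (\<Sum>y\<in>f ` A. k y)" by (rule sum_mono) (use assms in auto)
  finally show ?thesis .
qed

lemma card_fibres_ge:
  assumes "finite P" "\<And>x. x \<in> A \<Longrightarrow> k \<le> card {p \<in> P. f p = x}"
    and "finite A"
  shows "k * card A \<le> card P"
proof -
  have "k * card A = (\<Sum>x\<in>A. k)" by simp
  also have "\<dots> \<le> (\<Sum>x\<in>A. card {p \<in> P. f p = x})" by (rule sum_mono) (use assms in auto)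
  also have "\<dots> = card (\<Union>x\<in>A. {p \<in> P. f p = x})"
    by (rule card_UN_disjoint[symmetric]) (use assms in auto)
  also have "\<dots> \<le> card P" by (rule card_mono) (use assms in auto)
  finally show ?thesis .
qed

text \<open>Split the triples by runs. Among the edges of one run with \<open>forward\<close> at
  most \<open>R\<close>, the earliest has all the others in its own forward count, so each run
  contributes at most \<open>R\<close> triples.\<close>

lemma card_forward_le:
  assumes E: "finite E"
  shows "card {(f, g, z). (f, g, z) \<in> live E T \<and> forward E T f g z \<le> R} \<le> R * card (runs E T)"
proof -
  let ?A = "{(f, g, z). (f, g, z) \<in> live E T \<and> forward E T f g z \<le> R}"
  have fin: "finite ?A" by (rule finite_subset[OF _ finite_live[OF E]]) auto
  have "card ?A \<le> (\<Sum>i\<in>run_id E T ` ?A. R)"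
  proof (rule card_le_by_fibres[OF fin])
    fix i assume i: "i \<in> run_id E T ` ?A"
    obtain f z c where i_def: "i = (f, z, c)" by (cases i)
    let ?G = "{g. (f, g, z) \<in> ?A \<and> next_time E T f g z = c}"
    have eq: "{x \<in> ?A. run_id E T x = i} = (\<lambda>g. (f, g, z)) ` ?G"
      unfolding i_def run_id_def by auto
    have finG: "finite ?G"
      by (rule finite_subset[OF _ finite_row[OF E, of f "\<lambda>_. True"]]) (auto simp: live_def)
    have ne: "?G \<noteq> {}" using i unfolding i_def run_id_def by auto
    define g where "g = arg_min_on (T f) ?G"
    have g: "g \<in> ?G" "\<And>h. h \<in> ?G \<Longrightarrow> T f g \<le> T f h"
      using arg_min_if_finite[OF finG ne, of "T f"] unfolding g_def by (auto simp: not_less)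
    have "?G \<subseteq> {h. (f, h) \<in> E \<and> (z, h) \<in> E \<and> T f g \<le> T f h \<and> T f h < next_time E T f g z}"
    proof
      fix h assume h: "h \<in> ?G"
      then have l: "(f, h, z) \<in> live E T" by auto
      have "T f h < next_time E T f h z" by (rule next_time_greater[OF E l])
      then show "h \<in> {h. (f, h) \<in> E \<and> (z, h) \<in> E \<and> T f g \<le> T f h \<and> T f h < next_time E T f g z}"
        using h g l by (auto simp: live_def)
    qed
    then have "card ?G \<le> forward E T f g z"
      unfolding forward_def by (rule card_mono[OF finite_row[OF E]])
    also have "\<dots> \<le> R" using g by auto
    finally show "card {x \<in> ?A. run_id E T x = i} \<le> R"
      unfolding eq using card_image_le[OF finG, of "\<lambda>g. (f, g, z)"] by linarith
  qed
  also have "\<dots> = R * card (run_id E T ` ?A)" by simp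
  also have "\<dots> \<le> R * card (runs E T)"
    unfolding runs_def by (intro mult_left_mono card_mono) (auto simp: finite_live E)
  finally show ?thesis .
qed

section \<open>Blocked columns\<close>

definition rank :: "('a \<times> 'b) set \<Rightarrow> ('a \<Rightarrow> 'b \<Rightarrow> real) \<Rightarrow> 'a \<Rightarrow> 'b \<Rightarrow> 'a \<Rightarrow> nat" where
  "rank E T f g z = card {w. (w, g) \<in> E \<and> T f g < T w g \<and> T w g \<le> T z g}"

text \<open>
  The columns \<open>h\<close> whose run against \<open>g\<close> through \<open>(f, h)\<close> is not long and is trapped between \<open>(f, g)\<close>
  and one of the next \<open>\<rho>\<close> edges \<open>(z, g)\<close>. Columns swap the roles, hence the converse relation.
\<close>

definition blocked :: "('a \<times> 'b) set \<Rightarrow> ('a \<Rightarrow> 'b \<Rightarrow> real) \<Rightarrow> nat \<Rightarrow> nat \<Rightarrow> ('a \<times> 'b \<times> 'b) set" where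
  "blocked E T \<rho> R = {(f, g, h). (f, g) \<in> E \<and> (f, h) \<in> E \<and> T f g < T f h \<and>
     run_length (E\<inverse>) (flip T) (run_id (E\<inverse>) (flip T) (h, f, g)) \<le> R \<and>
     (\<exists>z. (z, g) \<in> E \<and> (z, h) \<in> E \<and> T f h < T z g \<and> rank E T f g z \<le> \<rho>)}"

lemma blocked_live:
  assumes "(f, g, h) \<in> blocked E T \<rho> R"
  shows "(h, f, g) \<in> live (E\<inverse>) (flip T)"
  using assms unfolding blocked_def live_def next_set_def by force

lemma finite_col: "finite E \<Longrightarrow> finite {w. (w, g) \<in> E \<and> P w}"
  by (rule finite_subset[of _ "fst ` E"]) force+

lemma finite_blocked: "finite E \<Longrightarrow> finite (blocked E T \<rho> R)"
  by (rule finite_subset[of _ "fst ` E \<times> snd ` E \<times> snd ` E"]) (force simp: blocked_def)+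

text \<open>
  The cutoff at \<open>\<rho>\<close> holds because all the edges \<open>(f, g)\<close> charged to one run lie among \<open>\<rho>\<close> consecutive
  edges of \<open>g\<close>. Using the run length alone would only give a cube root in place of the square root.
\<close>

lemma card_blocked_le:
  assumes E: "finite E" and sep: "separated E T"
  shows "card (blocked E T \<rho> R) \<le>
    (\<Sum>i\<in>{i \<in> runs (E\<inverse>) (flip T). run_length (E\<inverse>) (flip T) i \<le> R}.
        min (run_length (E\<inverse>) (flip T) i) \<rho>)"
proof -
  let ?B = "blocked E T \<rho> R" and ?len = "run_length (E\<inverse>) (flip T)"
  let ?id = "\<lambda>(f, g, h). run_id (E\<inverse>) (flip T) (h, f, g)"
  have E': "finite (E\<inverse>)" using E by simp
  have fin: "finite ?B" by (rule finite_blocked[OF E])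
  have "card ?B \<le> (\<Sum>i\<in>?id ` ?B. min (?len i) \<rho>)"
  proof (rule card_le_by_fibres[OF fin])
    fix i assume i: "i \<in> ?id ` ?B"
    obtain h g c where i_def: "i = (h, g, c)" by (cases i)
    let ?F = "{f. (f, g, h) \<in> ?B \<and> next_time (E\<inverse>) (flip T) h f g = c}"
    have eq: "{x \<in> ?B. ?id x = i} = (\<lambda>f. (f, g, h)) ` ?F"
      unfolding i_def run_id_def by auto
    have finF: "finite ?F"
      by (rule finite_subset[OF _ finite_col[OF E, of g "\<lambda>_. True"]]) (auto simp: blocked_def)
    have ne: "?F \<noteq> {}" using i unfolding i_def run_id_def by auto
    have card_eq: "card {x \<in> ?B. ?id x = i} = card ?F"
      unfolding eq by (rule card_image) (auto simp: inj_on_def)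
    have "card ?F \<le> ?len i"
    proof -
      have "(\<lambda>f. (h, f, g)) ` ?F \<subseteq> {x \<in> live (E\<inverse>) (flip T). run_id (E\<inverse>) (flip T) x = i}"
        using blocked_live unfolding i_def by (fastforce simp: run_id_def)
      then have "card ((\<lambda>f. (h, f, g)) ` ?F) \<le> ?len i"
        unfolding run_length_def by (rule card_mono[rotated]) (simp add: finite_live E)
      moreover have "card ((\<lambda>f. (h, f, g)) ` ?F) = card ?F"
        by (rule card_image) (auto simp: inj_on_def)
      ultimately show ?thesis by simp
    qed
    moreover have "card ?F \<le> \<rho>"
    proof -
      \<comment> \<open>All edges \<open>(w, g)\<close> charged to this run lie in the window from
        the earliest of them to the witness \<open>z\<close> of that earliest one, as
        \<open>T w g < T w h < c \<le> T z g\<close>. The rank bound for this single witness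
        therefore bounds the whole fibre.\<close>
      define f where "f = arg_min_on (\<lambda>f. T f g) ?F"
      have f: "f \<in> ?F" "\<And>w. w \<in> ?F \<Longrightarrow> T f g \<le> T w g"
        using arg_min_if_finite[OF finF ne, of "\<lambda>f. T f g"] unfolding f_def by (auto simp: not_less)
      then obtain z where z: "(z, g) \<in> E" "(z, h) \<in> E" "T f h < T z g" "rank E T f g z \<le> \<rho>"
        unfolding blocked_def by auto
      have "z \<in> next_set (E\<inverse>) (flip T) h f g" using z by (simp add: next_set_def)
      then have c: "c \<le> T z g" using next_time_le[OF E', of z "flip T" h f g] f(1) by auto
      let ?W = "{w. (w, g) \<in> E \<and> T f g < T w g \<and> T w g \<le> T z g}"
      have lt: "T w g < T z g" if "w \<in> ?F" for w
      proof -
        have b: "(w, g, h) \<in> ?B" using that by simp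
        then have "T w h < c" using next_time_greater[OF E' blocked_live[OF b]] that by simp
        then show ?thesis using c b by (auto simp: blocked_def)
      qed
      have fg: "T f g < T z g" using lt f(1) by blast
      have "w = f" if "w \<in> ?F" "T w g = T f g" for w
        using separatedD[OF sep that(2)] that(1) f(1) by (auto simp: blocked_def)
      \<comment> \<open>\<open>rank\<close> counts \<open>z\<close>, which is outside
        \<open>?F\<close>, and omits \<open>f\<close>, which is inside; the two cancel, so the bound
        is exactly \<rho>.\<close>
      then have "?F \<subseteq> insert f (?W - {z})"
        using f(2) lt by (fastforce simp: blocked_def)
      then have "card ?F \<le> card (insert f (?W - {z}))"
        by (rule card_mono[rotated]) (simp add: finite_col E)
      also have "\<dots> \<le> Suc (card (?W - {z}))" by (rule card_insert_le_m1) (auto simp: finite_col E)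
      also have "\<dots> = card ?W" using z(1) fg
        by (intro card_Suc_Diff1) (auto simp: finite_col E)
      finally show ?thesis using z(4) by (simp add: rank_def)
    qed
    ultimately show "card {x \<in> ?B. ?id x = i} \<le> min (?len i) \<rho>" using card_eq by simp
  qed
  also have "\<dots> \<le> (\<Sum>i\<in>{i \<in> runs (E\<inverse>) (flip T). ?len i \<le> R}. min (?len i) \<rho>)"
  proof (rule sum_mono2)
    show "finite {i \<in> runs (E\<inverse>) (flip T). ?len i \<le> R}"
      unfolding runs_def by (simp add: finite_live E)
    show "?id ` ?B \<subseteq> {i \<in> runs (E\<inverse>) (flip T). ?len i \<le> R}"
    proof
      fix i assume "i \<in> ?id ` ?B"
      then obtain f g h where b: "(f, g, h) \<in> ?B" and i: "i = run_id (E\<inverse>) (flip T) (h, f, g)" by auto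
      have "i \<in> runs (E\<inverse>) (flip T)" unfolding runs_def i by (rule imageI[OF blocked_live[OF b]])
      moreover have "?len i \<le> R" using b unfolding i blocked_def by simp
      ultimately show "i \<in> {i \<in> runs (E\<inverse>) (flip T). ?len i \<le> R}" by simp
    qed
  qed simp
  finally show ?thesis .
qed

section \<open>The local argument at one edge\<close>

lemma separated_col:
  "\<lbrakk>separated E T; (w, g) \<in> E; (z, g) \<in> E; w \<noteq> z\<rbrakk> \<Longrightarrow> T w g \<noteq> T z g"
  using separatedD by metis

lemma separated_row:
  "\<lbrakk>separated E T; (f, h) \<in> E; (f, g) \<in> E; h \<noteq> g\<rbrakk> \<Longrightarrow> T f h \<noteq> T f g"
  using separatedD by metis

text \<open>Let \<open>(f, h)\<close> with \<open>h \<noteq> g\<close> be counted by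
  \<open>forward\<close>. Both \<open>(f, g)\<close> and \<open>(z, g)\<close> are letters
  \<open>g\<close> in the word of \<open>h\<close> and \<open>g\<close>, so they trap the run of
  \<open>h\<close> through \<open>(f, h)\<close>. If that run had more than \<open>R\<close> edges,
  every other row \<open>w\<close> on it would end the run of \<open>f\<close> against
  \<open>w\<close> before \<open>T z g\<close>, hence within \<rho> edges of row \<open>f\<close> by
  \<open>row\<close>, against \<open>few\<close>. So \<open>h\<close> is blocked.\<close>

lemma forward_le_blocked:
  assumes E: "finite E" and sep: "separated E T"
    and fg: "(f, g) \<in> E" and zg: "(z, g) \<in> E" and less: "T f g < T z g"
    and rk: "rank E T f g z \<le> \<rho>"
    and row: "card {h. (f, h) \<in> E \<and> T f g < T f h \<and> T f h < T z g} < \<rho>"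
    and few: "card {w. (f, g, w) \<in> live E T \<and> forward E T f g w \<le> \<rho>} < R"
  shows "(f, g, z) \<in> live E T"
    and "forward E T f g z \<le> Suc (card {h. (f, g, h) \<in> blocked E T \<rho> R})"
proof -
  have E': "finite (E\<inverse>)" using E by simp
  have mem: "g \<in> next_set E T f g z" using fg zg less by (simp add: next_set_def)
  then show live: "(f, g, z) \<in> live E T" using fg zg less by (auto simp: live_def)
  have nt: "next_time E T f g z \<le> T z g" by (rule next_time_le[OF E mem])
  have "{h. (f, h) \<in> E \<and> (z, h) \<in> E \<and> T f g \<le> T f h \<and> T f h < next_time E T f g z}
      \<subseteq> insert g {h. (f, g, h) \<in> blocked E T \<rho> R}" (is "?S \<subseteq> _")
  proof (rule subsetI, rule ccontr)
    fix h assume "h \<in> ?S" and notin: "h \<notin> insert g {h. (f, g, h) \<in> blocked E T \<rho> R}"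
    then have fh: "(f, h) \<in> E" and zh: "(z, h) \<in> E" and le: "T f g \<le> T f h"
      and lt: "T f h < T z g" and ne: "h \<noteq> g"
      using nt by auto
    have "T f h \<noteq> T f g" by (rule separated_row[OF sep fh fg ne])
    then have lt': "T f g < T f h" using le by simp
    let ?id = "run_id (E\<inverse>) (flip T)" and ?L = "live (E\<inverse>) (flip T)"
    define c where "c = next_time (E\<inverse>) (flip T) h f g"
    have zn: "z \<in> next_set (E\<inverse>) (flip T) h f g" using zg zh lt by (simp add: next_set_def)
    have c_le: "c \<le> T z g" unfolding c_def using next_time_le[OF E' zn] .
    have c_gt: "T f h < c"
      unfolding c_def using next_time_greater[OF E', of h f g "flip T"] zn fh fg ne by (auto simp: live_def)
    have "\<not> run_length (E\<inverse>) (flip T) (?id (h, f, g)) \<le> R"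
      using notin fg fh lt' zg zh lt rk by (auto simp: blocked_def)
    then have long: "R < card {x \<in> ?L. ?id x = ?id (h, f, g)}" by (simp add: run_length_def)
    let ?Y = "{w. (h, w, g) \<in> ?L \<and> next_time (E\<inverse>) (flip T) h w g = c}"
    have finY: "finite ?Y"
      by (rule finite_subset[OF _ finite_col[OF E, of h "\<lambda>_. True"]]) (auto simp: live_def)
    have "{x \<in> ?L. ?id x = ?id (h, f, g)} = (\<lambda>w. (h, w, g)) ` ?Y"
      unfolding run_id_def c_def by auto
    then have "R < card ?Y" using long card_image_le[OF finY, of "\<lambda>w. (h, w, g)"] by simp
    \<comment> \<open>The run has strictly more than \<open>R\<close> edges, which pays for
      discarding \<open>f\<close>.\<close>
    then have R: "R \<le> card (?Y - {f})"
      using card_Diff1_le[of ?Y f] finY by (cases "f \<in> ?Y") auto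
    have "?Y - {f} \<subseteq> {w. (f, g, w) \<in> live E T \<and> forward E T f g w \<le> \<rho>}"
    proof
      fix w assume w: "w \<in> ?Y - {f}"
      then have wh: "(w, h) \<in> E" and wg: "(w, g) \<in> E" and wl: "(h, w, g) \<in> ?L"
        and wc: "next_time (E\<inverse>) (flip T) h w g = c" and wf: "w \<noteq> f"
        by (auto simp: live_def)
      have w_lt: "T w h < c" using next_time_greater[OF E' wl] wc by simp
      \<comment> \<open>Otherwise \<open>(f, g)\<close> would be a \<open>g\<close>-edge after
        \<open>(w, h)\<close> and before \<open>c\<close>, and the run through \<open>(w, h)\<close>
        would end there. Equality of times is excluded because \<open>(w, h)\<close> and
        \<open>(f, g)\<close> are opposite in a 4-cycle.\<close>
      have w_gt: "T f g < T w h"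
      proof (rule ccontr)
        assume "\<not> T f g < T w h"
        moreover have "T w h \<noteq> T f g" using separatedD[OF sep _ wh fg wg fh] wf by blast
        ultimately have "f \<in> next_set (E\<inverse>) (flip T) h w g" using fg fh by (simp add: next_set_def)
        from next_time_le[OF E' this] wc lt' c_gt show False by simp
      qed
      have hn: "h \<in> next_set E T f g w" using fh wh w_gt by (simp add: next_set_def)
      have "(f, g, w) \<in> live E T" using fg wg wf hn by (auto simp: live_def)
      moreover have "forward E T f g w \<le> \<rho>"
      proof -
        have "next_time E T f g w \<le> T w h" by (rule next_time_le[OF E hn])
        then have nt': "next_time E T f g w < T z g" using w_lt c_le by simp
        have "{k. (f, k) \<in> E \<and> (w, k) \<in> E \<and> T f g \<le> T f k \<and> T f k < next_time E T f g w}
          \<subseteq> insert g {k. (f, k) \<in> E \<and> T f g < T f k \<and> T f k < T z g}" (is "?A \<subseteq> insert g ?B")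
        proof
          fix k assume k: "k \<in> ?A"
          show "k \<in> insert g ?B"
          proof (cases "k = g")
            case False
            then have "T f k \<noteq> T f g" using separated_row[OF sep _ fg] k by simp
            then show ?thesis using k nt' by auto
          qed simp
        qed
        then have "card ?A \<le> card (insert g ?B)"
          by (rule card_mono[rotated]) (simp add: finite_row E)
        also have "\<dots> \<le> Suc (card ?B)" by (rule card_insert_le_m1) (auto simp: finite_row E)
        also have "\<dots> \<le> \<rho>" using row by simp
        finally show ?thesis by (simp add: forward_def)
      qed
      ultimately show "w \<in> {w. (f, g, w) \<in> live E T \<and> forward E T f g w \<le> \<rho>}" by simp
    qed
    then have "card (?Y - {f}) \<le> card {w. (f, g, w) \<in> live E T \<and> forward E T f g w \<le> \<rho>}"
      by (rule card_mono[rotated])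
        (rule finite_subset[OF _ finite_col[OF E, of g "\<lambda>_. True"]], auto simp: live_def)
    then show False using R few by simp
  qed
  moreover have fB: "finite {h. (f, g, h) \<in> blocked E T \<rho> R}"
    by (rule finite_subset[OF _ finite_row[OF E, of f "\<lambda>_. True"]]) (auto simp: blocked_def)
  ultimately have "card ?S \<le> card (insert g {h. (f, g, h) \<in> blocked E T \<rho> R})"
    by (intro card_mono) auto
  also have "\<dots> \<le> Suc (card {h. (f, g, h) \<in> blocked E T \<rho> R})"
    by (rule card_insert_le_m1) (auto simp: fB)
  finally show "forward E T f g z \<le> Suc (card {h. (f, g, h) \<in> blocked E T \<rho> R})"
    by (simp add: forward_def)
qed

text \<open>The first \<open>k\<close> elements in order of \<open>t\<close>, collected by
  repeatedly adding a minimiser of the rest. Ties may occur, hence the weak inequality.\<close>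

lemma initial_segment:
  fixes t :: "'a \<Rightarrow> real"
  assumes "finite S" "k \<le> card S"
  shows "\<exists>A\<subseteq>S. card A = k \<and> (\<forall>a\<in>A. \<forall>w\<in>S - A. t a \<le> t w)"
  using assms(2)
proof (induction k)
  case (Suc k)
  then obtain A where A: "A \<subseteq> S" "card A = k" "\<forall>a\<in>A. \<forall>w\<in>S - A. t a \<le> t w" by auto
  have fA: "finite A" using A(1) assms(1) by (rule finite_subset)
  have "S - A \<noteq> {}" using A Suc.prems card_mono[OF fA, of S] by auto
  then obtain m where m: "m \<in> S - A" "\<forall>w\<in>S - A. t m \<le> t w"
    using arg_min_if_finite[of "S - A" t] assms(1) by (metis finite_Diff not_less)
  have "insert m A \<subseteq> S" "card (insert m A) = Suc k" using m A fA by auto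
  moreover have "\<forall>a\<in>insert m A. \<forall>w\<in>S - insert m A. t a \<le> t w" using m A by auto
  ultimately show ?case by blast
qed auto

lemma finite_max_attained:
  fixes t :: "'a \<Rightarrow> real"
  assumes "finite S" "S \<noteq> {}"
  shows "\<exists>m\<in>S. \<forall>a\<in>S. t a \<le> t m"
proof -
  have "Max (t ` S) \<in> t ` S" using assms by (intro Max_in) auto
  then obtain m where "m \<in> S" "t m = Max (t ` S)" by auto
  moreover have "t a \<le> Max (t ` S)" if "a \<in> S" for a using assms that by simp
  ultimately show ?thesis by metis
qed

text \<open>\<open>A\<close> and \<open>B\<close> stand for the first \<rho> successors of
  \<open>(f, g)\<close> in its column and in its row. If some edge of \<open>B\<close> is no earlier
  than all of \<open>A\<close>, then every \<open>z\<close> in \<open>A\<close> meets the rank and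
  row bounds of \<open>forward_le_blocked\<close>, so all \<rho> rows in \<open>A\<close> have a
  small forward count.\<close>

lemma card_forward_ge:
  assumes E: "finite E" and sep: "separated E T" and fg: "(f, g) \<in> E" and \<rho>: "0 < \<rho>"
    and few: "card {w. (f, g, w) \<in> live E T \<and> forward E T f g w \<le> \<rho>} < R"
    and bl: "card {h. (f, g, h) \<in> blocked E T \<rho> R} < b"
    and A: "A \<subseteq> {w. (w, g) \<in> E \<and> T f g < T w g}" "card A = \<rho>"
      "\<And>a w. a \<in> A \<Longrightarrow> (w, g) \<in> E \<Longrightarrow> T f g < T w g \<Longrightarrow> w \<notin> A \<Longrightarrow> T a g \<le> T w g"
    and B: "card B = \<rho>"
      "\<And>h k. h \<in> B \<Longrightarrow> (f, k) \<in> E \<Longrightarrow> T f g < T f k \<Longrightarrow> k \<notin> B \<Longrightarrow> T f h \<le> T f k"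
    and h: "h \<in> B" "\<And>a. a \<in> A \<Longrightarrow> T a g \<le> T f h"
  shows "\<rho> \<le> card {w. (f, g, w) \<in> live E T \<and> forward E T f g w \<le> b}"
proof -
  have finB: "finite B" using B(1) \<rho> by (intro card_ge_0_finite) simp
  have finA: "finite A" using A(2) \<rho> by (intro card_ge_0_finite) simp
  have "A \<subseteq> {w. (f, g, w) \<in> live E T \<and> forward E T f g w \<le> b}"
  proof
    fix z assume z: "z \<in> A"
    then have zg: "(z, g) \<in> E" "T f g < T z g" using A(1) by auto
    have "{w. (w, g) \<in> E \<and> T f g < T w g \<and> T w g \<le> T z g} \<subseteq> A"
    proof (rule subsetI, rule ccontr)
      fix w assume w: "w \<in> {w. (w, g) \<in> E \<and> T f g < T w g \<and> T w g \<le> T z g}" "w \<notin> A"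
      then have "T w g = T z g" using A(3)[OF z, of w] by auto
      moreover have "w \<noteq> z" using w(2) z by blast
      ultimately show False using separated_col[OF sep _ zg(1), of w] w(1) by simp
    qed
    then have rk: "rank E T f g z \<le> \<rho>"
      unfolding rank_def using card_mono[OF finA] A(2) by auto
    \<comment> \<open>The edge \<open>(f, h)\<close> does not precede \<open>(z, g)\<close>, so
      \<open>h\<close> drops out of the count; this makes the bound strict.\<close>
    have "{k. (f, k) \<in> E \<and> T f g < T f k \<and> T f k < T z g} \<subseteq> B - {h}"
      using B(2)[OF h(1)] h(2)[OF z] by force
    then have "card {k. (f, k) \<in> E \<and> T f g < T f k \<and> T f k < T z g} \<le> card (B - {h})"
      using finB by (intro card_mono) auto
    also have "\<dots> < \<rho>" using B(1) h(1) finB \<rho> by simp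
    finally have row: "card {k. (f, k) \<in> E \<and> T f g < T f k \<and> T f k < T z g} < \<rho>" .
    show "z \<in> {w. (f, g, w) \<in> live E T \<and> forward E T f g w \<le> b}"
      using forward_le_blocked[OF E sep fg zg rk row few] bl by simp
  qed
  then have "card A \<le> card {w. (f, g, w) \<in> live E T \<and> forward E T f g w \<le> b}"
    by (rule card_mono[rotated])
      (rule finite_subset[OF _ finite_col[OF E, of g "\<lambda>_. True"]], auto simp: live_def)
  then show ?thesis using A(2) by simp
qed

text \<open>If both the column and the row have \<rho> successors, compare the last of the first
  \<rho> in each. One outcome is the situation of \<open>card_forward_ge\<close>, the other is that
  situation for the converse relation; hence the alternatives come in transposed pairs.\<close>

lemma edge_exceptional:
  assumes E: "finite E" and sep: "separated E T" and fg: "(f, g) \<in> E" and \<rho>: "0 < \<rho>"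
  shows "card {w. (w, g) \<in> E \<and> T f g < T w g} < \<rho> \<or> card {h. (f, h) \<in> E \<and> T f g < T f h} < \<rho> \<or>
    R \<le> card {w. (f, g, w) \<in> live E T \<and> forward E T f g w \<le> \<rho>} \<or>
    R \<le> card {h. (g, f, h) \<in> live (E\<inverse>) (flip T) \<and> forward (E\<inverse>) (flip T) g f h \<le> \<rho>} \<or>
    \<rho> \<le> card {w. (f, g, w) \<in> live E T \<and> forward E T f g w \<le> b} \<or>
    \<rho> \<le> card {h. (g, f, h) \<in> live (E\<inverse>) (flip T) \<and> forward (E\<inverse>) (flip T) g f h \<le> b} \<or>
    b \<le> card {h. (f, g, h) \<in> blocked E T \<rho> R} \<or>
    b \<le> card {w. (g, f, w) \<in> blocked (E\<inverse>) (flip T) \<rho> R}"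
proof (rule ccontr, unfold de_Morgan_disj, elim conjE)
  assume col: "\<not> card {w. (w, g) \<in> E \<and> T f g < T w g} < \<rho>"
    and row: "\<not> card {h. (f, h) \<in> E \<and> T f g < T f h} < \<rho>"
    and u1: "\<not> R \<le> card {w. (f, g, w) \<in> live E T \<and> forward E T f g w \<le> \<rho>}"
    and u2: "\<not> R \<le> card {h. (g, f, h) \<in> live (E\<inverse>) (flip T) \<and> forward (E\<inverse>) (flip T) g f h \<le> \<rho>}"
    and v1: "\<not> \<rho> \<le> card {w. (f, g, w) \<in> live E T \<and> forward E T f g w \<le> b}"
    and v2: "\<not> \<rho> \<le> card {h. (g, f, h) \<in> live (E\<inverse>) (flip T) \<and> forward (E\<inverse>) (flip T) g f h \<le> b}"
    and b1: "\<not> b \<le> card {h. (f, g, h) \<in> blocked E T \<rho> R}"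
    and b2: "\<not> b \<le> card {w. (g, f, w) \<in> blocked (E\<inverse>) (flip T) \<rho> R}"
  have col': "\<rho> \<le> card {w. (w, g) \<in> E \<and> T f g < T w g}" using col by simp
  have row': "\<rho> \<le> card {h. (f, h) \<in> E \<and> T f g < T f h}" using row by simp
  obtain A where A: "A \<subseteq> {w. (w, g) \<in> E \<and> T f g < T w g}" "card A = \<rho>"
      "\<forall>a\<in>A. \<forall>w\<in>{w. (w, g) \<in> E \<and> T f g < T w g} - A. T a g \<le> T w g"
    using initial_segment[OF finite_col[OF E] col', where t = "\<lambda>w. T w g"] by blast
  obtain B where B: "B \<subseteq> {h. (f, h) \<in> E \<and> T f g < T f h}" "card B = \<rho>"
      "\<forall>a\<in>B. \<forall>w\<in>{h. (f, h) \<in> E \<and> T f g < T f h} - B. T f a \<le> T f w"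
    using initial_segment[OF finite_row[OF E] row', where t = "T f"] by blast
  have fin: "finite A" "finite B" "A \<noteq> {}" "B \<noteq> {}"
    using A(2) B(2) \<rho> by (auto intro: card_ge_0_finite)
  have A': "T a g \<le> T w g" if "a \<in> A" "(w, g) \<in> E" "T f g < T w g" "w \<notin> A" for a w
    using A(3) that by auto
  have B': "T f a \<le> T f w" if "a \<in> B" "(f, w) \<in> E" "T f g < T f w" "w \<notin> B" for a w
    using B(3) that by auto
  obtain x where x: "x \<in> A" "\<And>a. a \<in> A \<Longrightarrow> T a g \<le> T x g"
    using finite_max_attained[OF fin(1,3), where t = "\<lambda>w. T w g"] by blast
  obtain y where y: "y \<in> B" "\<And>a. a \<in> B \<Longrightarrow> T f a \<le> T f y"
    using finite_max_attained[OF fin(2,4), where t = "T f"] by blast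
  show False
  proof (cases "T x g \<le> T f y")
    case True
    have "\<rho> \<le> card {w. (f, g, w) \<in> live E T \<and> forward E T f g w \<le> b}"
    proof (rule card_forward_ge[OF E sep fg \<rho> _ _ A(1,2) A' B(2) B' y(1)])
      show "T a g \<le> T f y" if "a \<in> A" for a using x(2)[OF that] True by simp
      show "card {w. (f, g, w) \<in> live E T \<and> forward E T f g w \<le> \<rho>} < R" using u1 by simp
      show "card {h. (f, g, h) \<in> blocked E T \<rho> R} < b" using b1 by simp
    qed
    then show False using v1 by simp
  next
    case False
    have "\<rho> \<le> card {h. (g, f, h) \<in> live (E\<inverse>) (flip T) \<and> forward (E\<inverse>) (flip T) g f h \<le> b}"
    proof (rule card_forward_ge[where A = B and B = A and h = x and R = R,
          OF _ separated_converse[OF sep] _ \<rho> _ _ _ B(2) _ A(2) _ x(1)])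
      show "finite (E\<inverse>)" "(g, f) \<in> E\<inverse>" using E fg by simp_all
      show "T f a \<le> T x g" if "a \<in> B" for a using y(2)[OF that] False by simp
      show "card {h. (g, f, h) \<in> live (E\<inverse>) (flip T) \<and> forward (E\<inverse>) (flip T) g f h \<le> \<rho>} < R"
        using u2 by simp
      show "card {w. (g, f, w) \<in> blocked (E\<inverse>) (flip T) \<rho> R} < b" using b2 by simp
      show "B \<subseteq> {w. (w, f) \<in> E\<inverse> \<and> T f g < T f w}" using B(1) by simp
      show "T f a \<le> T f w" if "a \<in> B" "(w, f) \<in> E\<inverse>" "T f g < T f w" "w \<notin> B" for a w
        using B' that by simp
      show "T a g \<le> T w g" if "a \<in> A" "(g, w) \<in> E\<inverse>" "T f g < T w g" "w \<notin> A" for a w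
        using A' that by simp
    qed
    then show False using v2 by simp
  qed
qed

section \<open>Counting exceptional edges\<close>

definition exceptional :: "('a \<times> 'b) set \<Rightarrow> ('a \<Rightarrow> 'b \<Rightarrow> real) \<Rightarrow> nat \<Rightarrow> nat \<Rightarrow> nat \<Rightarrow> ('a \<times> 'b) set"
  where "exceptional E T \<rho> R b = {(f, g) \<in> E. card {w. (w, g) \<in> E \<and> T f g < T w g} < \<rho> \<or>
    R \<le> card {w. (f, g, w) \<in> live E T \<and> forward E T f g w \<le> \<rho>} \<or>
    \<rho> \<le> card {w. (f, g, w) \<in> live E T \<and> forward E T f g w \<le> b} \<or>
    b \<le> card {h. (f, g, h) \<in> blocked E T \<rho> R}}"

text \<open>The eight alternatives of \<open>edge_exceptional\<close> are four for \<open>E\<close>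
  and the same four for the converse, so only one orientation has to be counted.\<close>

lemma edges_exceptional:
  assumes "finite E" "separated E T" "0 < \<rho>"
  shows "E \<subseteq> exceptional E T \<rho> R b \<union> (exceptional (E\<inverse>) (flip T) \<rho> R b)\<inverse>"
proof
  fix e assume "e \<in> E"
  moreover obtain f g where "e = (f, g)" by (cases e)
  ultimately show "e \<in> exceptional E T \<rho> R b \<union> (exceptional (E\<inverse>) (flip T) \<rho> R b)\<inverse>"
    using edge_exceptional[OF assms(1,2) _ assms(3), of f g R b] unfolding exceptional_def by auto
qed

text \<open>Markov's inequality in counting form.\<close>

lemma markov_card:
  assumes P: "finite P" and X: "finite X"
    and k: "\<And>f g. (f, g) \<in> X \<Longrightarrow> k \<le> card {w. (f, g, w) \<in> P}"
  shows "k * card X \<le> card P"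
proof (rule card_fibres_ge[OF P _ X, where f = "\<lambda>(f, g, w). (f, g)"])
  fix x assume "x \<in> X"
  then obtain f g where x: "x = (f, g)" and fg: "(f, g) \<in> X" by (cases x) auto
  have "{p \<in> P. (case p of (f, g, w) \<Rightarrow> (f, g)) = x} = (\<lambda>w. (f, g, w)) ` {w. (f, g, w) \<in> P}"
    unfolding x by auto
  moreover have "card ((\<lambda>w. (f, g, w)) ` {w. (f, g, w) \<in> P}) = card {w. (f, g, w) \<in> P}"
    by (rule card_image) (auto simp: inj_on_def)
  ultimately show "k \<le> card {p \<in> P. (case p of (f, g, w) \<Rightarrow> (f, g)) = x}"
    using k[OF fg] by simp
qed

text \<open>Within one column, the earliest edge with fewer than \<rho> later ones has all other
  such edges after it, so there are at most \<rho> of them.\<close>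

lemma card_late_le:
  assumes E: "finite E" and sep: "separated E T"
  shows "card {(f, g) \<in> E. card {w. (w, g) \<in> E \<and> T f g < T w g} < \<rho>} \<le> \<rho> * card (snd ` E)"
proof -
  let ?X = "{(f, g) \<in> E. card {w. (w, g) \<in> E \<and> T f g < T w g} < \<rho>}"
  have fin: "finite ?X" by (rule finite_subset[OF _ E]) auto
  have "card ?X \<le> (\<Sum>g\<in>snd ` ?X. \<rho>)"
  proof (rule card_le_by_fibres[OF fin])
    fix g assume g: "g \<in> snd ` ?X"
    let ?F = "{f. (f, g) \<in> ?X}"
    have eq: "{x \<in> ?X. snd x = g} = (\<lambda>f. (f, g)) ` ?F" by auto
    have finF: "finite ?F"
      by (rule finite_subset[OF _ finite_col[OF E, of g "\<lambda>_. True"]]) auto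
    have "?F \<noteq> {}" using g by auto
    then obtain f where f: "f \<in> ?F" "\<forall>w\<in>?F. - T w g \<le> - T f g"
      using finite_max_attained[OF finF, where t = "\<lambda>w. - T w g"] by blast
    let ?W = "{w. (w, g) \<in> E \<and> T f g < T w g}"
    have "?F \<subseteq> insert f ?W"
    proof
      fix w assume w: "w \<in> ?F"
      show "w \<in> insert f ?W"
      proof (cases "w = f")
        case False
        then have "T w g \<noteq> T f g" using separated_col[OF sep _ _ False] w f(1) by simp
        moreover have "T f g \<le> T w g" using f(2) w by auto
        ultimately show ?thesis using w by simp
      qed simp
    qed
    then have "card ?F \<le> card (insert f ?W)"
      by (rule card_mono[rotated]) (simp add: finite_col E)
    also have "\<dots> \<le> Suc (card ?W)" by (rule card_insert_le_m1) (auto simp: finite_col E)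
    also have "\<dots> \<le> \<rho>" using f(1) by simp
    finally show "card {x \<in> ?X. snd x = g} \<le> \<rho>"
      unfolding eq using card_image_le[OF finF, of "\<lambda>f. (f, g)"] by linarith
  qed
  also have "\<dots> = \<rho> * card (snd ` ?X)" by simp
  also have "\<dots> \<le> \<rho> * card (snd ` E)" by (intro mult_left_mono card_mono) (auto simp: E)
  finally show ?thesis .
qed

text \<open>A union bound over the four reasons in \<open>exceptional\<close>, in their order there.
  The last three come from Markov's inequality, the middle two together with
  \<open>card_forward_le\<close>.\<close>

lemma card_exceptional_le:
  assumes E: "finite E" and sep: "separated E T" and pos: "0 < \<rho>" "0 < R" "0 < b"
  shows "real (card (exceptional E T \<rho> R b)) \<le> real \<rho> * card (snd ` E)
    + real \<rho> * card (runs E T) / R + real b * card (runs E T) / \<rho> + card (blocked E T \<rho> R) / b"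
proof -
  let ?P = "\<lambda>k. {(f, g, z). (f, g, z) \<in> live E T \<and> forward E T f g z \<le> k}"
  let ?U = "\<lambda>j k. {(f, g) \<in> E. k \<le> card {w. (f, g, w) \<in> live E T \<and> forward E T f g w \<le> j}}"
  let ?X1 = "{(f, g) \<in> E. card {w. (w, g) \<in> E \<and> T f g < T w g} < \<rho>}"
  let ?X4 = "{(f, g) \<in> E. b \<le> card {h. (f, g, h) \<in> blocked E T \<rho> R}}"
  have U: "real (card (?U j k)) \<le> real j * card (runs E T) / k" if "0 < k" for j k
  proof -
    have "k * card (?U j k) \<le> card (?P j)"
    proof (rule markov_card)
      show "finite (?P j)" by (rule finite_subset[OF _ finite_live[OF E]]) auto
      show "finite (?U j k)" by (rule finite_subset[OF _ E]) auto
    qed auto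
    also have "\<dots> \<le> j * card (runs E T)" by (rule card_forward_le[OF E])
    finally have "real k * real (card (?U j k)) \<le> real j * real (card (runs E T))"
      by (simp only: of_nat_mult[symmetric] of_nat_le_iff)
    then show ?thesis using that by (simp add: field_simps)
  qed
  have "b * card ?X4 \<le> card (blocked E T \<rho> R)"
    by (rule markov_card[OF finite_blocked[OF E]]) (auto intro: finite_subset[OF _ E])
  then have "real b * real (card ?X4) \<le> real (card (blocked E T \<rho> R))"
    by (simp only: of_nat_mult[symmetric] of_nat_le_iff)
  then have X4: "real (card ?X4) \<le> card (blocked E T \<rho> R) / b"
    using pos by (simp add: field_simps)
  have "exceptional E T \<rho> R b = ?X1 \<union> ?U \<rho> R \<union> ?U b \<rho> \<union> ?X4"
    unfolding exceptional_def by auto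
  then have "card (exceptional E T \<rho> R b) \<le> card ?X1 + card (?U \<rho> R) + card (?U b \<rho>) + card ?X4"
    by (simp only:) (intro order_trans[OF card_Un_le] add_right_mono order_refl)
  then have "real (card (exceptional E T \<rho> R b))
      \<le> real (card ?X1) + real (card (?U \<rho> R)) + real (card (?U b \<rho>)) + real (card ?X4)"
    by (simp only: of_nat_add[symmetric] of_nat_le_iff)
  moreover have "real (card ?X1) \<le> real \<rho> * card (snd ` E)"
    using card_late_le[OF E sep, of \<rho>] by (simp only: of_nat_mult[symmetric] of_nat_le_iff)
  moreover have "real (card (?U \<rho> R)) \<le> real \<rho> * card (runs E T) / R" by (rule U[OF pos(2)])
  moreover have "real (card (?U b \<rho>)) \<le> real b * card (runs E T) / \<rho>" by (rule U[OF pos(1)])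
  ultimately show ?thesis using X4 by linarith
qed

section \<open>Pigeonhole over scales\<close>

definition medium :: "('a \<times> 'b) set \<Rightarrow> ('a \<Rightarrow> 'b \<Rightarrow> real) \<Rightarrow> nat \<Rightarrow> nat \<Rightarrow> ('a \<times> 'a \<times> real) set" where
  "medium E T r R = {i \<in> runs E T. r < run_length E T i \<and> run_length E T i \<le> R}"

lemma finite_runs: "finite E \<Longrightarrow> finite (runs E T)"
  unfolding runs_def by (simp add: finite_live)

text \<open>In the sum of \<open>card_blocked_le\<close>, a run of length at most \<open>r\<close>
  is charged \<open>r\<close> and a medium one the cutoff \<rho>.\<close>

lemma card_blocked_le_medium:
  assumes E: "finite E" and sep: "separated E T"
  shows "card (blocked E T \<rho> R) \<le>
    r * card (runs (E\<inverse>) (flip T)) + \<rho> * card (medium (E\<inverse>) (flip T) r R)"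
proof -
  let ?I = "runs (E\<inverse>) (flip T)" and ?len = "run_length (E\<inverse>) (flip T)"
  let ?M = "medium (E\<inverse>) (flip T) r R"
  have finI: "finite ?I" using E by (simp add: finite_runs)
  have finM: "finite ?M" unfolding medium_def using finI by simp
  have "card (blocked E T \<rho> R) \<le> (\<Sum>i\<in>{i \<in> ?I. ?len i \<le> R}. min (?len i) \<rho>)"
    by (rule card_blocked_le[OF E sep])
  also have "\<dots> \<le> (\<Sum>i\<in>(?I - ?M) \<union> ?M. if i \<in> ?M then \<rho> else r)"
    by (rule order_trans[OF sum_mono[where g = "\<lambda>i. if i \<in> ?M then \<rho> else r"] sum_mono2])
      (auto simp: medium_def finI)
  also have "\<dots> = (\<Sum>i\<in>?I - ?M. if i \<in> ?M then \<rho> else r) + (\<Sum>i\<in>?M. if i \<in> ?M then \<rho> else r)"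
    by (rule sum.union_disjoint) (auto simp: finI finM)
  also have "\<dots> = r * card (?I - ?M) + \<rho> * card ?M" by simp
  also have "\<dots> \<le> r * card ?I + \<rho> * card ?M"
    by (intro add_mono mult_left_mono card_mono) (auto simp: finI finM)
  finally show ?thesis .
qed

lemma sum_medium_le:
  assumes E: "finite E" and K: "1 \<le> (K::nat)"
  shows "(\<Sum>a<L. card (medium E T (K ^ a) (K ^ Suc a))) \<le> card (runs E T)"
proof -
  have "(\<Sum>a<L. card (medium E T (K ^ a) (K ^ Suc a)))
      = card (\<Union>a<L. medium E T (K ^ a) (K ^ Suc a))"
  proof (rule card_UN_disjoint[symmetric])
    have "medium E T (K ^ a) (K ^ Suc a) \<inter> medium E T (K ^ a') (K ^ Suc a') = {}" if "a < a'" for a a'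
    proof -
      have "K ^ Suc a \<le> K ^ a'" by (rule power_increasing) (use that K in auto)
      then show ?thesis unfolding medium_def by auto
    qed
    then show "\<forall>a\<in>{..<L}. \<forall>a'\<in>{..<L}. a \<noteq> a' \<longrightarrow>
        medium E T (K ^ a) (K ^ Suc a) \<inter> medium E T (K ^ a') (K ^ Suc a') = {}"
      by (metis Int_commute linorder_neq_iff)
  qed (auto simp: medium_def finite_runs E)
  also have "\<dots> \<le> card (runs E T)"
    by (rule card_mono) (auto simp: medium_def finite_runs E)
  finally show ?thesis .
qed

text \<open>Otherwise, at a scale with few medium runs, the bounds of
  \<open>card_exceptional_le\<close> for \<open>E\<close> and its converse add up to seven tenths of
  the number of edges, although the exceptional edges cover \<open>E\<close>.\<close>

lemma many_runs:
  assumes E: "finite E" and sep: "separated E T"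
    and n: "card (fst ` E) \<le> n" "card (snd ` E) \<le> n"
    and s: "1 \<le> (s::nat)" and ne: "E \<noteq> {}"
    and large: "10 * n * (500 * s ^ 3) ^ (50 * s ^ 2) \<le> card E"
  shows "s * card E < card (runs E T) + card (runs (E\<inverse>) (flip T))"
proof (rule ccontr)
  define m where "m = card E"
  define Q where "Q = card (runs E T) + card (runs (E\<inverse>) (flip T))"
  \<comment> \<open>\<open>K\<close> is the ratio \<open>R / r\<close> required below and
    \<open>L\<close> the number of scales. Averaging over \<open>L = 50 s^2\<close> scales yields
    one with \<open>M a \<le> Q / L \<le> m / (50 s)\<close>.\<close>
  define K where "K = 500 * s ^ 3"
  define L where "L = 50 * s ^ 2"
  define M where "M a = card (medium E T (K ^ a) (K ^ Suc a)) +
    card (medium (E\<inverse>) (flip T) (K ^ a) (K ^ Suc a))" for a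
  assume "\<not> s * card E < card (runs E T) + card (runs (E\<inverse>) (flip T))"
  then have Q: "Q \<le> s * m" by (simp add: Q_def m_def)
  have E': "finite (E\<inverse>)" using E by simp
  have m: "0 < m" unfolding m_def using E ne by (simp add: card_gt_0_iff)
  have K: "1 \<le> K" using s by (simp add: K_def)
  have L: "0 < L" using s by (simp add: L_def)
  have sumM: "(\<Sum>a<L. M a) \<le> Q"
    unfolding M_def Q_def sum.distrib by (intro add_mono sum_medium_le E E' K)
  have "\<exists>a<L. L * M a \<le> Q"
  proof (rule ccontr)
    assume "\<not> (\<exists>a<L. L * M a \<le> Q)"
    then have "\<And>a. a \<in> {..<L} \<Longrightarrow> Q < L * M a" by auto
    then have "(\<Sum>a<L. Q) < (\<Sum>a<L. L * M a)" using L by (intro sum_strict_mono) auto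
    also have "\<dots> = L * (\<Sum>a<L. M a)" by (simp add: sum_distrib_left)
    also have "\<dots> \<le> L * Q" using sumM by simp
    finally show False by simp
  qed
  then obtain a where a: "a < L" "L * M a \<le> Q" by blast
  define r where "r = K ^ a"
  \<comment> \<open>The successive ratios are \<open>b / r = 10 s\<close>,
    \<open>\<rho> / b = 5 s\<close> and \<open>R / \<rho> = 10 s\<close>, with product
    \<open>K\<close>. Each turns a term in \<open>Q\<close> into a multiple of \<open>Q / s\<close>,
    which is at most that multiple of \<open>m\<close>.\<close>
  define b where "b = 10 * s * r"
  define \<rho> where "\<rho> = 50 * s ^ 2 * r"
  define R where "R = K ^ Suc a"
  have r: "0 < r" using K by (simp add: r_def)
  have R_eq: "R = 500 * s ^ 3 * r" by (simp add: R_def r_def K_def)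
  have pos: "0 < \<rho>" "0 < R" "0 < b" using r s by (simp_all add: \<rho>_def R_eq b_def)
  have Ma: "50 * s * M a \<le> m"
  proof -
    have "s * (50 * s * M a) = L * M a" by (simp add: L_def power2_eq_square)
    then have "s * (50 * s * M a) \<le> s * m" using a(2) Q by linarith
    then show ?thesis using s by simp
  qed
  have "\<rho> \<le> R" unfolding \<rho>_def R_eq
    by (intro mult_right_mono mult_mono power_increasing s) auto
  \<comment> \<open>Since \<open>a < L\<close>, the exponent \<open>Suc a\<close> is still at most
    \<open>L\<close>. Via \<open>large\<close> this keeps the late edges, at most
    \<open>2 n \<rho>\<close> of them, below a fifth of \<open>m\<close>.\<close>
  also have "R \<le> K ^ L" unfolding R_def by (rule power_increasing) (use a(1) K in auto)
  finally have "10 * n * \<rho> \<le> 10 * n * K ^ L" by simp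
  also have "\<dots> \<le> m" using large by (simp add: K_def L_def m_def)
  finally have n\<rho>: "10 * n * \<rho> \<le> m" .
  have B1: "card (blocked E T \<rho> R) \<le>
      r * card (runs (E\<inverse>) (flip T)) + \<rho> * card (medium (E\<inverse>) (flip T) r R)"
    by (rule card_blocked_le_medium[OF E sep])
  have B2: "card (blocked (E\<inverse>) (flip T) \<rho> R) \<le> r * card (runs E T) + \<rho> * card (medium E T r R)"
    using card_blocked_le_medium[OF E' separated_converse[OF sep], of \<rho> R r] by simp
  have B: "card (blocked E T \<rho> R) + card (blocked (E\<inverse>) (flip T) \<rho> R) \<le> r * Q + \<rho> * M a"
    using B1 B2 unfolding Q_def M_def r_def R_def by (simp add: algebra_simps)
  have "card E \<le> card (exceptional E T \<rho> R b \<union> (exceptional (E\<inverse>) (flip T) \<rho> R b)\<inverse>)"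
    by (rule card_mono[OF _ edges_exceptional[OF E sep pos(1)]])
      (auto intro!: finite_subset[OF _ E] finite_subset[OF _ E'] simp: exceptional_def)
  also have "\<dots> \<le> card (exceptional E T \<rho> R b) + card (exceptional (E\<inverse>) (flip T) \<rho> R b)"
    using card_Un_le[of "exceptional E T \<rho> R b" "(exceptional (E\<inverse>) (flip T) \<rho> R b)\<inverse>"] by simp
  finally have "real m \<le> real (card (exceptional E T \<rho> R b))
      + real (card (exceptional (E\<inverse>) (flip T) \<rho> R b))"
    unfolding m_def by linarith
  also have "\<dots> \<le> (real \<rho> * card (snd ` E)
        + real \<rho> * card (runs E T) / R + real b * card (runs E T) / \<rho> + card (blocked E T \<rho> R) / b)
      + (real \<rho> * card (snd ` (E\<inverse>)) + real \<rho> * card (runs (E\<inverse>) (flip T)) / R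
        + real b * card (runs (E\<inverse>) (flip T)) / \<rho> + card (blocked (E\<inverse>) (flip T) \<rho> R) / b)"
    by (intro add_mono card_exceptional_le E E' sep separated_converse pos)
  also have "\<dots> = real \<rho> * (real (card (snd ` E)) + real (card (snd ` (E\<inverse>)))) + real \<rho> * Q / R
      + real b * Q / \<rho> + (real (card (blocked E T \<rho> R)) + real (card (blocked (E\<inverse>) (flip T) \<rho> R))) / b"
    unfolding Q_def by (simp add: add_divide_distrib ring_distribs)
  also have "\<dots> \<le> m / 5 + m / 10 + m / 5 + m / 5"
  proof (intro add_mono)
    have "snd ` (E\<inverse>) = fst ` E" by force
    then have "real (card (snd ` E)) + real (card (snd ` (E\<inverse>))) \<le> 2 * real n" using n by simp
    then have "real \<rho> * (real (card (snd ` E)) + real (card (snd ` (E\<inverse>)))) \<le> real \<rho> * (2 * real n)"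
      by (rule mult_left_mono) simp
    also have "\<dots> = real (10 * n * \<rho>) / 5" by simp
    also have "\<dots> \<le> m / 5" using n\<rho> by (intro divide_right_mono of_nat_mono) auto
    finally show "real \<rho> * (real (card (snd ` E)) + real (card (snd ` (E\<inverse>)))) \<le> m / 5" .
    have Q': "real Q / s \<le> m"
      using Q s by (simp add: field_simps flip: of_nat_mult)
    have sr: "real s > 0" "real r > 0" using s r by auto
    have "real \<rho> * Q / R = real Q / s / 10"
      using sr by (simp add: \<rho>_def R_eq field_simps power2_eq_square power3_eq_cube)
    then show "real \<rho> * Q / R \<le> m / 10" using Q' by simp
    have "real b * Q / \<rho> = real Q / s / 5"
      using sr by (simp add: \<rho>_def b_def field_simps power2_eq_square)
    then show "real b * Q / \<rho> \<le> m / 5" using Q' by simp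
    have "(real (card (blocked E T \<rho> R)) + real (card (blocked (E\<inverse>) (flip T) \<rho> R))) / b
        \<le> real (r * Q + \<rho> * M a) / b"
      using B by (intro divide_right_mono) (simp_all flip: of_nat_add)
    also have "\<dots> = real Q / s / 10 + real (50 * s * M a) / 10"
      using sr by (simp add: \<rho>_def b_def field_simps power2_eq_square)
    also have "\<dots> \<le> m / 10 + m / 10"
      using Q' Ma by (intro add_mono divide_right_mono of_nat_mono) auto
    finally show "(real (card (blocked E T \<rho> R)) + real (card (blocked (E\<inverse>) (flip T) \<rho> R))) / b \<le> m / 5"
      by simp
  qed
  finally show False using m by simp
qed

section \<open>From runs to crossing points\<close>

definition height :: "(real \<times> real) set \<Rightarrow> real \<Rightarrow> real" where
  "height s x = (THE y. (x, y) \<in> s)"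

lemma height_fun_graph: "height (fun_graph f) = f"
  by (rule ext) (simp add: height_def fun_graph_def)

lemma curve_height:
  assumes "bi_infinite_x_monotone_curve s"
  shows "continuous_on UNIV (height s)" "s = fun_graph (height s)"
  using assms unfolding bi_infinite_x_monotone_curve_def by (auto simp: height_fun_graph)

lemma curve_mem_iff:
  assumes "bi_infinite_x_monotone_curve s"
  shows "(x, y) \<in> s \<longleftrightarrow> y = height s x"
  using curve_height(2)[OF assms] unfolding fun_graph_def by blast

lemma continuous_meet:
  fixes f g :: "real \<Rightarrow> real"
  assumes "continuous_on UNIV f" "continuous_on UNIV g" "a < b" "f a < g a" "g b < f b"
  shows "\<exists>x. a < x \<and> x < b \<and> f x = g x"
proof -
  have "\<exists>x\<ge>a. x \<le> b \<and> f x - g x = 0"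
    by (rule IVT') (use assms in \<open>auto intro!: continuous_intros intro: continuous_on_subset\<close>)
  then obtain x where x: "a \<le> x" "x \<le> b" "f x = g x" by auto
  then have "x \<noteq> a" "x \<noteq> b" using assms by auto
  then show ?thesis using x by (intro exI[of _ x]) auto
qed

text \<open>Away from \<open>x0\<close> the curves do not meet, so by the intermediate value theorem
  their order is constant on either side; \<open>a\<close> and \<open>b\<close> lie on different
  sides and tell which order it is.\<close>

lemma single_meet_order:
  fixes f g :: "real \<Rightarrow> real"
  assumes c: "continuous_on UNIV f" "continuous_on UNIV g" and u: "\<And>x. f x = g x \<Longrightarrow> x = x0"
    and ab: "a < b" "f a < g a" "g b < f b"
  shows "x < x0 \<Longrightarrow> f x < g x" "x0 < x \<Longrightarrow> g x < f x"
proof -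
  obtain y where y: "a < y" "y < b" "f y = g y" using continuous_meet[OF c ab] by blast
  then have x0: "a < x0" "x0 < b" using u by auto
  have no: "f y < g y \<longleftrightarrow> f z < g z" if "y < z" "z < x0 \<or> x0 < y" for y z
  proof -
    have "f y \<noteq> g y" "f z \<noteq> g z" using u[of y] u[of z] that by auto
    then show ?thesis
      using continuous_meet[OF c that(1)] continuous_meet[OF c(2,1) that(1)] u that(2)
      by (smt (verit))
  qed
  show "f x < g x" if "x < x0"
    using no[of a x] no[of x a] ab(2) x0 that by (cases x a rule: linorder_cases) auto
  show "g x < f x" if "x0 < x"
  proof -
    have "\<not> f x < g x"
      using no[of b x] no[of x b] ab(3) x0 that by (cases x b rule: linorder_cases) auto
    moreover have "f x \<noteq> g x" using u[of x] that by auto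
    ultimately show ?thesis by simp
  qed
qed

text \<open>If the order differed at two abscissae, \<open>single_meet_order\<close> would make the
  only common point a proper crossing.\<close>

lemma touching_point_order:
  assumes s: "bi_infinite_x_monotone_curve s1" "bi_infinite_x_monotone_curve s2"
    and p: "touching_point s1 s2 p"
  shows "(\<forall>x. height s1 x \<le> height s2 x) \<or> (\<forall>x. height s2 x \<le> height s1 x)"
proof (rule ccontr)
  let ?f = "height s1" and ?g = "height s2"
  assume "\<not> ?thesis"
  then obtain a b where a: "?f a < ?g a" and b: "?g b < ?f b" by (auto simp: not_le)
  have P: "s1 \<inter> s2 = {p}" "\<not> properly_cross_at s1 s2 p"
    using p by (auto simp: touching_point_def)
  have u: "x = fst p" if "?f x = ?g x" for x
  proof -
    have "(x, ?f x) \<in> s1 \<inter> s2" using that by (simp add: curve_mem_iff s)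
    then show ?thesis using P(1) by auto
  qed
  note c = curve_height(1)[OF s(1)] curve_height(1)[OF s(2)]
  have ev: "\<forall>\<^sub>F x in at_left (fst p). x < fst p" "\<forall>\<^sub>F x in at_right (fst p). fst p < x"
    by (auto simp: eventually_at_filter)
  have g: "s1 = fun_graph ?f" "s2 = fun_graph ?g" using curve_height(2) s by blast+
  consider "a < b" | "b < a" using a b by (metis less_asym linorder_neqE)
  then have "properly_cross_at s1 s2 p"
  proof cases
    case 1
    note o = single_meet_order[OF c u 1 a b]
    have "\<forall>\<^sub>F x in at_left (fst p). ?f x < ?g x" "\<forall>\<^sub>F x in at_right (fst p). ?g x < ?f x"
      using ev by (auto elim!: eventually_mono intro: o)
    then show ?thesis unfolding properly_cross_at_def using P(1) g by blast
  next
    case 2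
    note o = single_meet_order[OF c(2,1) u[OF sym] 2 b a]
    have "\<forall>\<^sub>F x in at_left (fst p). ?g x < ?f x" "\<forall>\<^sub>F x in at_right (fst p). ?f x < ?g x"
      using ev by (auto elim!: eventually_mono intro: o)
    then show ?thesis unfolding properly_cross_at_def using P(1) g by blast
  qed
  then show False using P(2) by simp
qed

lemma general_position_subset:
  assumes "general_position S" "F \<subseteq> S"
  shows "general_position F"
proof -
  note * = assms(1)[unfolded general_position_def]
  show ?thesis
    unfolding general_position_def
    using conjunct1[OF *, rule_format] conjunct2[OF *, rule_format] subsetD[OF assms(2)]
    by simp
qed

text \<open>An infinite set has \<open>card\<close> 0, so an injection into the crossing points
  bounds their number only once finiteness is known.\<close>

lemma finite_crossing_points:
  assumes "finite S" "general_position S"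
  shows "finite (crossing_points S)"
proof -
  have "crossing_points S \<subseteq> (\<Union>s1\<in>S. \<Union>s2\<in>S - {s1}. s1 \<inter> s2)"
    unfolding crossing_points_def crossing_point_def by blast
  moreover have "finite (\<Union>s1\<in>S. \<Union>s2\<in>S - {s1}. s1 \<inter> s2)"
    by (intro finite_UN_I) (use assms in \<open>auto simp: general_position_def\<close>)
  ultimately show ?thesis by (rule finite_subset)
qed

section \<open>Distinct crossing points from run ends\<close>

definition word_times :: "('a \<times> 'b) set \<Rightarrow> ('a \<Rightarrow> 'b \<Rightarrow> real) \<Rightarrow> 'a \<Rightarrow> 'a \<Rightarrow> real set" where
  "word_times E T f z = {t. \<exists>h. (f, h) \<in> E \<and> (z, h) \<in> E \<and> (t = T f h \<or> t = T z h)}"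

lemma word_times_commute: "word_times E T f z = word_times E T z f"
  unfolding word_times_def by blast

text \<open>Take \<open>g\<close> last in the run. A time of the word strictly between
  \<open>T f g\<close> and \<open>c\<close> would belong to a \<open>z\<close>-edge that ends the
  run earlier, or to an \<open>f\<close>-edge of the same run later than \<open>g\<close>.\<close>

lemma run_end:
  assumes E: "finite E" and i: "(f, z, c) \<in> runs E T"
  obtains g h where "(f, g) \<in> E" "(z, g) \<in> E" "(f, h) \<in> E" "(z, h) \<in> E" "c = T z h" "T f g < c"
    "f \<noteq> z" "word_times E T f z \<inter> {T f g<..<c} = {}"
proof -
  let ?G = "{g. (f, g, z) \<in> live E T \<and> next_time E T f g z = c}"
  have finG: "finite ?G"
    by (rule finite_subset[OF _ finite_row[OF E, of f "\<lambda>_. True"]]) (auto simp: live_def)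
  have "?G \<noteq> {}" using i by (auto simp: runs_def run_id_def)
  then obtain g where g: "g \<in> ?G" "\<And>k. k \<in> ?G \<Longrightarrow> T f k \<le> T f g"
    using finite_max_attained[OF finG, where t = "T f"] by blast
  have live: "(f, g, z) \<in> live E T" and nt: "next_time E T f g z = c" using g(1) by auto
  have fz: "(f, g) \<in> E" "(z, g) \<in> E" "f \<noteq> z" "next_set E T f g z \<noteq> {}"
    using live by (auto simp: live_def)
  obtain h where h: "h \<in> next_set E T f g z" "c = T z h"
    using next_time_attained[OF E fz(4)] nt by metis
  have "t \<notin> word_times E T f z" if t: "T f g < t" "t < c" for t
  proof
    assume "t \<in> word_times E T f z"
    then obtain k where k: "(f, k) \<in> E" "(z, k) \<in> E" "t = T f k \<or> t = T z k"
      by (auto simp: word_times_def)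
    have "t \<noteq> T z k"
    proof
      assume "t = T z k"
      then have "k \<in> next_set E T f g z" using k t by (simp add: next_set_def)
      from next_time_le[OF E this] show False using \<open>t = T z k\<close> nt t(2) by simp
    qed
    then have tk: "t = T f k" using k(3) by simp
    have hk: "h \<in> next_set E T f k z" using h t tk by (simp add: next_set_def)
    have "next_time E T f k z \<le> c" using next_time_le[OF E hk] h(2) by simp
    moreover have "c \<le> next_time E T f k z"
    proof -
      obtain h' where h': "h' \<in> next_set E T f k z" "next_time E T f k z = T z h'"
        using next_time_attained[OF E] hk by blast
      then have "h' \<in> next_set E T f g z" using t(1) tk by (simp add: next_set_def)
      from next_time_le[OF E this] show ?thesis using h' nt by simp
    qed
    ultimately have "k \<in> ?G" using k fz(3) hk by (auto simp: live_def)
    then show False using g(2) t(1) tk by fastforce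
  qed
  then have "word_times E T f z \<inter> {T f g<..<c} = {}" by auto
  moreover have "T f g < c" using next_time_greater[OF E live] nt by simp
  ultimately show thesis using that fz h by (auto simp: next_set_def)
qed

text \<open>The order of \<open>f\<close> and \<open>z\<close> is reversed between the last edge of
  the run and the edge ending it, so they cross in this gap of their word. By general position the
  crossing point determines the two curves, and the gap containing it determines the run. The sign
  \<sigma> serves both families: \<open>1\<close> for the lower curves, \<open>-1\<close> for the
  upper ones.\<close>

lemma card_runs_le_crossing_points:
  fixes E :: "((real \<times> real) set \<times> 'b) set"
  assumes E: "finite E" and sep: "separated E T"
    and S: "finite S" "\<And>s. s \<in> S \<Longrightarrow> bi_infinite_x_monotone_curve s" "general_position S"
    and dom: "\<And>f g. (f, g) \<in> E \<Longrightarrow> f \<in> S"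
    and \<sigma>: "\<sigma> = 1 \<or> \<sigma> = (-1::real)"
    and strict: "\<And>f g z. \<lbrakk>(f, g) \<in> E; (z, g) \<in> E; f \<noteq> z\<rbrakk> \<Longrightarrow>
      \<sigma> * height z (T f g) < \<sigma> * height f (T f g)"
  shows "card (runs E T) \<le> card (crossing_points S)"
proof -
  define Q where "Q i x \<longleftrightarrow> (case i of (f, z, c) \<Rightarrow> f \<in> S \<and> z \<in> S \<and> f \<noteq> z \<and>
      crossing_point f z (x, height f x) \<and>
      (\<exists>l h. l \<in> word_times E T f z \<and> l < x \<and> x < c \<and> (f, h) \<in> E \<and> (z, h) \<in> E \<and> c = T z h \<and>
        word_times E T f z \<inter> {l<..<c} = {}))" for i x
  have ex: "\<exists>x. Q i x" if "i \<in> runs E T" for i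
  proof -
    obtain f z c where i: "i = (f, z, c)" by (cases i)
    have "(f, z, c) \<in> runs E T" using that i by simp
    from run_end[OF E this]
    obtain g h where gh: "(f, g) \<in> E" "(z, g) \<in> E" "(f, h) \<in> E" "(z, h) \<in> E" "c = T z h"
      "T f g < c" "f \<noteq> z" "word_times E T f z \<inter> {T f g<..<c} = {}"
      by metis
    have fz: "f \<in> S" "z \<in> S" using dom gh by blast+
    note cf = S(2)[OF fz(1)] and cz = S(2)[OF fz(2)]
    have l: "\<sigma> * height z (T f g) < \<sigma> * height f (T f g)" by (rule strict[OF gh(1,2,7)])
    have r: "\<sigma> * height f c < \<sigma> * height z c"
      unfolding gh(5) by (rule strict[OF gh(4,3) gh(7)[symmetric]])
    have "\<exists>x. T f g < x \<and> x < c \<and> \<sigma> * height z x = \<sigma> * height f x"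
      by (rule continuous_meet[OF _ _ gh(6) l r])
        (intro continuous_intros curve_height(1) cf cz)+
    then obtain x where x: "T f g < x" "x < c" "height z x = height f x" using \<sigma> by auto
    \<comment> \<open>Touching curves are weakly ordered everywhere, whereas here the strict order
      at \<open>T f g\<close> is opposite to that at \<open>c\<close>.\<close>
    have "crossing_point f z (x, height f x)"
    proof -
      have "\<not> touching_point f z (x, height f x)"
      proof
        assume "touching_point f z (x, height f x)"
        from touching_point_order[OF cf cz this]
        consider "height f (T f g) \<le> height z (T f g)" "height f c \<le> height z c"
          | "height z (T f g) \<le> height f (T f g)" "height z c \<le> height f c" by blast
        then show False using l r \<sigma> by cases auto
      qed
      then show ?thesis unfolding crossing_point_def using x(3) by (simp add: curve_mem_iff cf cz)
    qed
    moreover have "T f g \<in> word_times E T f z" using gh by (auto simp: word_times_def)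
    ultimately have "Q i x" unfolding Q_def i using fz gh x by auto
    then show ?thesis ..
  qed
  define \<xi> where "\<xi> i = (SOME x. Q i x)" for i
  have \<xi>: "Q i (\<xi> i)" if "i \<in> runs E T" for i
    unfolding \<xi>_def using someI_ex[OF ex[OF that]] .
  define pt where "pt i = (\<xi> i, height (fst i) (\<xi> i))" for i
  have "inj_on pt (runs E T)"
  proof (rule inj_onI)
    fix i j assume i: "i \<in> runs E T" and j: "j \<in> runs E T" and eq: "pt i = pt j"
    obtain f z c where i_eq: "i = (f, z, c)" by (cases i)
    obtain f' z' c' where j_eq: "j = (f', z', c')" by (cases j)
    define x where "x = \<xi> i"
    have x': "\<xi> j = x" using eq by (simp add: pt_def x_def)
    have hh: "height f x = height f' x" using eq by (auto simp: pt_def x_def i_eq j_eq)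
    have Qi: "Q (f, z, c) x" using \<xi>[OF i] by (simp add: x_def i_eq)
    have Qj: "Q (f', z', c') x" using \<xi>[OF j] x' by (simp add: j_eq)
    obtain l h where A: "f \<in> S" "z \<in> S" "f \<noteq> z" "crossing_point f z (x, height f x)"
      "l \<in> word_times E T f z" "l < x" "x < c" "(f, h) \<in> E" "(z, h) \<in> E" "c = T z h"
      "word_times E T f z \<inter> {l<..<c} = {}"
      using Qi unfolding Q_def by auto
    obtain l' h' where B: "f' \<in> S" "z' \<in> S" "f' \<noteq> z'" "crossing_point f' z' (x, height f' x)"
      "l' \<in> word_times E T f' z'" "l' < x" "x < c'" "(f', h') \<in> E" "(z', h') \<in> E" "c' = T z' h'"
      "word_times E T f' z' \<inter> {l'<..<c'} = {}"
      using Qj unfolding Q_def by auto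
    have mem: "(x, height f x) \<in> f" "(x, height f x) \<in> z" "(x, height f x) \<in> f'" "(x, height f x) \<in> z'"
      using A(4) B(4) hh by (auto simp: crossing_point_def)
    have three: "s1 = s2 \<or> s1 = s3 \<or> s2 = s3"
      if "s1 \<in> S" "s2 \<in> S" "s3 \<in> S" "(x, height f x) \<in> s1" "(x, height f x) \<in> s2" "(x, height f x) \<in> s3"
      for s1 s2 s3
      using S(3) that unfolding general_position_def by blast
    have "f' = f \<or> f' = z" using three[of f' f z] A B mem by blast
    moreover have "z' = f \<or> z' = z" using three[of z' f z] A B mem by blast
    ultimately consider "f' = f" "z' = z" | "f' = z" "z' = f" using B(3) by blast
    then have same: "word_times E T f' z' = word_times E T f z"
      by cases (auto simp: word_times_commute)
    have cW: "c \<in> word_times E T f z" using A by (auto simp: word_times_def)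
    have cW': "c' \<in> word_times E T f z" unfolding same[symmetric] using B by (auto simp: word_times_def)
    \<comment> \<open>Both gaps belong to the same word and contain \<open>x\<close>, and neither
      contains the right end of the other; hence the right ends agree.\<close>
    have "c \<notin> {l'<..<c'}" "c' \<notin> {l<..<c}" using A(11) B(11) cW cW' same by blast+
    then have cc: "c = c'" using A(6,7) B(6,7) by auto
    \<comment> \<open>With the roles swapped, \<open>c\<close> would be the time of both
      \<open>(z, h)\<close> and \<open>(f, h')\<close>, which \<open>separated\<close>
      forbids.\<close>
    have "\<not> (f' = z \<and> z' = f)"
    proof
      assume sw: "f' = z \<and> z' = f"
      have "T z h = T f h'" using cc A(10) B(10) sw by simp
      from separatedD[OF sep this] show False using A(3,8,9) B(8,9) sw by blast
    qed
    then have "f' = f" "z' = z" using \<open>f' = f \<or> f' = z\<close> \<open>z' = f \<or> z' = z\<close> B(3) by blast+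
    then show "i = j" using cc i_eq j_eq by simp
  qed
  moreover have "pt ` runs E T \<subseteq> crossing_points S"
  proof
    fix p assume "p \<in> pt ` runs E T"
    then obtain i where i: "i \<in> runs E T" "p = pt i" by blast
    then show "p \<in> crossing_points S"
      using \<xi>[OF i(1)] unfolding Q_def pt_def crossing_points_def by (cases i) auto
  qed
  ultimately show ?thesis
    by (rule card_inj_on_le[OF _ _ finite_crossing_points[OF S(1,3)]])
qed

section \<open>The graph of touching pairs and its times\<close>

definition below_pairs :: "(real \<times> real) set set \<Rightarrow> (real \<times> real) set set \<Rightarrow>
    ((real \<times> real) set \<times> (real \<times> real) set) set" where
  "below_pairs F G = {(f, g). f \<in> F \<and> g \<in> G \<and> (\<exists>p. f \<inter> g = {p}) \<and> (\<forall>x. height f x \<le> height g x)}"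

definition meet_time :: "(real \<times> real) set \<Rightarrow> (real \<times> real) set \<Rightarrow> real" where
  "meet_time f g = fst (the_elem (f \<inter> g))"

lemma below_pairs_meet:
  assumes "\<And>s. s \<in> F \<union> G \<Longrightarrow> bi_infinite_x_monotone_curve s" "(f, g) \<in> below_pairs F G"
  shows "height f (meet_time f g) = height g (meet_time f g)" "f \<noteq> g"
proof -
  have c: "bi_infinite_x_monotone_curve f" "bi_infinite_x_monotone_curve g"
    using assms by (auto simp: below_pairs_def)
  obtain p where p: "f \<inter> g = {p}" using assms(2) by (auto simp: below_pairs_def)
  obtain x y where xy: "p = (x, y)" by (cases p)
  have "(x, y) \<in> f" "(x, y) \<in> g" using p xy by auto
  moreover have "meet_time f g = x" by (simp add: meet_time_def p xy)
  ultimately show "height f (meet_time f g) = height g (meet_time f g)"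
    by (simp add: curve_mem_iff c)
  show "f \<noteq> g"
  proof
    assume "f = g"
    then have "f = {p}" using p by simp
    moreover have "(x + 1, height f (x + 1)) \<in> f" by (simp add: curve_mem_iff c)
    ultimately show False using xy by simp
  qed
qed

lemma no_triple_meet:
  assumes "\<And>s. s \<in> S \<Longrightarrow> bi_infinite_x_monotone_curve s" "general_position S"
    and "s1 \<in> S" "s2 \<in> S" "s3 \<in> S" "s1 \<noteq> s2" "s1 \<noteq> s3" "s2 \<noteq> s3"
    and "height s1 x = height s2 x"
  shows "height s1 x \<noteq> height s3 x"
proof
  assume "height s1 x = height s3 x"
  then have "(x, height s1 x) \<in> s1 \<inter> s2 \<inter> s3" using assms by (simp add: curve_mem_iff)
  then show False using assms(2-8) unfolding general_position_def by blast
qed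

text \<open>At the touching time of \<open>f\<close> and \<open>g\<close>, the curve
  \<open>z\<close> is weakly below \<open>g\<close> and thus below \<open>f\<close>; equality would
  put three curves through one point. The second claim is the mirror image.\<close>

lemma below_pairs_strict:
  assumes c: "\<And>s. s \<in> F \<union> G \<Longrightarrow> bi_infinite_x_monotone_curve s"
    and gp: "general_position (F \<union> G)" and fg: "(f, g) \<in> below_pairs F G"
  shows "(z, g) \<in> below_pairs F G \<Longrightarrow> f \<noteq> z \<Longrightarrow>
      height z (meet_time f g) < height f (meet_time f g)"
    and "(f, h) \<in> below_pairs F G \<Longrightarrow> g \<noteq> h \<Longrightarrow>
      height g (meet_time f g) < height h (meet_time f g)"
proof -
  let ?t = "meet_time f g"
  note m = below_pairs_meet[OF c fg]
  have S: "f \<in> F \<union> G" "g \<in> F \<union> G" using fg by (auto simp: below_pairs_def)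
  show "height z ?t < height f ?t" if z: "(z, g) \<in> below_pairs F G" "f \<noteq> z"
  proof -
    have "z \<in> F \<union> G" "height z ?t \<le> height g ?t" using z(1) by (auto simp: below_pairs_def)
    moreover have "height f ?t \<noteq> height z ?t"
      using no_triple_meet[OF c gp S _ m(2) z(2) _ m(1)] calculation(1) below_pairs_meet(2)[OF c z(1)]
      by metis
    ultimately show ?thesis using m(1) by simp
  qed
  show "height g ?t < height h ?t" if h: "(f, h) \<in> below_pairs F G" "g \<noteq> h"
  proof -
    have "h \<in> F \<union> G" "height f ?t \<le> height h ?t" using h(1) by (auto simp: below_pairs_def)
    moreover have "height f ?t \<noteq> height h ?t"
      using no_triple_meet[OF c gp S _ m(2) _ h(2) m(1)] calculation(1) below_pairs_meet(2)[OF c h(1)]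
      by metis
    ultimately show ?thesis using m(1) by simp
  qed
qed

text \<open>If the two times agreed and \<open>f \<noteq> f'\<close>, then
  \<open>below_pairs_strict\<close> would put \<open>f'\<close> below \<open>f\<close> by way of
  \<open>g\<close>, and \<open>f\<close> below \<open>f'\<close> by way of \<open>g'\<close>. If
  \<open>f = f'\<close>, the same contradiction arises for \<open>g\<close> and
  \<open>g'\<close>.\<close>

lemma separated_below_pairs:
  assumes c: "\<And>s. s \<in> F \<union> G \<Longrightarrow> bi_infinite_x_monotone_curve s"
    and gp: "general_position (F \<union> G)"
  shows "separated (below_pairs F G) meet_time"
  unfolding separated_def
proof (intro allI impI notI)
  let ?E = "below_pairs F G"
  fix f g f' g'
  assume e: "(f, g) \<in> ?E" "(f', g') \<in> ?E" "(f, g') \<in> ?E" "(f', g) \<in> ?E" "(f, g) \<noteq> (f', g')"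
    and eq: "meet_time f g = meet_time f' g'"
  show False
  proof (cases "f = f'")
    case False
    have "height f' (meet_time f g) < height f (meet_time f g)"
      by (rule below_pairs_strict(1)[OF c gp e(1,4) False])
    moreover have "height f (meet_time f' g') < height f' (meet_time f' g')"
      by (rule below_pairs_strict(1)[OF c gp e(2,3)]) (use False in auto)
    ultimately show False using eq by simp
  next
    case True
    then have ne: "g \<noteq> g'" using e(5) by simp
    have "height g (meet_time f g) < height g' (meet_time f g)"
      by (rule below_pairs_strict(2)[OF c gp e(1,3) ne])
    moreover have "height g' (meet_time f' g') < height g (meet_time f' g')"
      by (rule below_pairs_strict(2)[OF c gp e(2,4)]) (use ne in auto)
    ultimately show False using eq by simp
  qed
qed

lemma crossing_points_lower_bound:
  fixes s n :: nat
  assumes fin: "finite F" "finite G" and card: "card F \<le> n" "card G \<le> n"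
    and c: "\<And>s. s \<in> F \<union> G \<Longrightarrow> bi_infinite_x_monotone_curve s"
    and gp: "general_position (F \<union> G)"
    and s: "1 \<le> s" and ne: "below_pairs F G \<noteq> {}"
    and large: "10 * n * (500 * s ^ 3) ^ (50 * s ^ 2) \<le> card (below_pairs F G)"
  shows "s * card (below_pairs F G) \<le> card (crossing_points F) + card (crossing_points G)"
proof -
  let ?E = "below_pairs F G" and ?T = meet_time
  have sub: "?E \<subseteq> F \<times> G" by (auto simp: below_pairs_def)
  have E: "finite ?E" using finite_subset[OF sub] fin by simp
  have gpF: "general_position F" "general_position G"
    by (rule general_position_subset[OF gp], simp)+
  note sep = separated_below_pairs[OF c gp]
  have "fst ` ?E \<subseteq> F" "snd ` ?E \<subseteq> G" using sub by auto
  then have "card (fst ` ?E) \<le> n" "card (snd ` ?E) \<le> n"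
    using card_mono[OF fin(1), of "fst ` ?E"] card_mono[OF fin(2), of "snd ` ?E"] card by linarith+
  from many_runs[OF E sep this s ne large]
  have "s * card ?E \<le> card (runs ?E ?T) + card (runs (?E\<inverse>) (flip ?T))" by simp
  also have "\<dots> \<le> card (crossing_points F) + card (crossing_points G)"
  proof (rule add_mono)
    show "card (runs ?E ?T) \<le> card (crossing_points F)"
    proof (rule card_runs_le_crossing_points[OF E sep fin(1) _ gpF(1), where \<sigma> = 1])
      show "1 * height z (?T f g) < 1 * height f (?T f g)"
        if "(f, g) \<in> ?E" "(z, g) \<in> ?E" "f \<noteq> z" for f g z
        using below_pairs_strict(1)[OF c gp that] by simp
    qed (use c sub in auto)
    show "card (runs (?E\<inverse>) (flip ?T)) \<le> card (crossing_points G)"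
    proof (rule card_runs_le_crossing_points[OF _ separated_converse[OF sep] fin(2) _ gpF(2),
          where \<sigma> = "-1"])
      show "- 1 * height h (?T f g) < - 1 * height g (?T f g)"
        if "(g, f) \<in> ?E\<inverse>" "(h, f) \<in> ?E\<inverse>" "g \<noteq> h" for f g h
        using below_pairs_strict(2)[OF c gp] that by simp
    qed (use c sub E in auto)
  qed
  finally show ?thesis .
qed

text \<open>\<open>touching_point_order\<close> orients every touching pair. In
  \<open>below_pairs\<close> the weak order takes the place of the condition that there is no proper
  crossing.\<close>

lemma touching_pairs_subset:
  assumes "\<And>s. s \<in> S1 \<union> S2 \<Longrightarrow> bi_infinite_x_monotone_curve s"
  shows "touching_pairs S1 S2 \<subseteq> below_pairs S1 S2 \<union> (below_pairs S2 S1)\<inverse>"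
proof
  fix e assume "e \<in> touching_pairs S1 S2"
  then obtain s1 s2 p where e: "e = (s1, s2)" "s1 \<in> S1" "s2 \<in> S2" and p: "touching_point s1 s2 p"
    by (auto simp: touching_pairs_def touch_def)
  have "s1 \<inter> s2 = {p}" "s2 \<inter> s1 = {p}" using p by (auto simp: touching_point_def)
  then show "e \<in> below_pairs S1 S2 \<union> (below_pairs S2 S1)\<inverse>"
    using touching_point_order[OF _ _ p] assms e by (auto simp: below_pairs_def)
qed

section \<open>Choice of parameters and conclusion\<close>

lemma parameter_choice:
  "\<exists>C>0. \<forall>t>C. \<exists>s::nat. 1 \<le> s \<and> sqrt (ln t / ln (ln t)) / 40 \<le> s \<and>
     20 * real ((500 * s ^ 3) ^ (50 * s ^ 2)) \<le> t"
proof -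
  have "\<forall>\<^sub>F t::real in at_top. 400 \<le> ln t / ln (ln t)" by real_asymp
  moreover have "\<forall>\<^sub>F t::real in at_top. 9 \<le> ln (ln t)" by real_asymp
  moreover have "\<forall>\<^sub>F t::real in at_top. 10 \<le> ln t" by real_asymp
  moreover have "\<forall>\<^sub>F t::real in at_top. 0 < t" by (rule eventually_gt_at_top)
  ultimately have "\<forall>\<^sub>F t::real in at_top. 400 \<le> ln t / ln (ln t) \<and> 9 \<le> ln (ln t) \<and> 10 \<le> ln t \<and> 0 < t"
    by eventually_elim auto
  then obtain C where C: "\<And>t. C \<le> t \<Longrightarrow>
      400 \<le> ln t / ln (ln t) \<and> 9 \<le> ln (ln t) \<and> 10 \<le> ln t \<and> 0 < (t::real)"
    unfolding eventually_at_top_linorder by blast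
  show ?thesis
  proof (intro exI[of _ "max C 1"] conjI allI impI)
    fix t :: real assume "max C 1 < t"
    then have t: "400 \<le> ln t / ln (ln t)" "9 \<le> ln (ln t)" "10 \<le> ln t" "0 < t" using C[of t] by auto
    define y where "y = ln t"
    define w where "w = ln y"
    define S where "S = sqrt (y / w)"
    \<comment> \<open>The 20 gives \<open>s^2 \<le> y / (400 w)\<close>, which keeps the exponent
      \<open>125 w s^2\<close> below \<open>y / 2\<close>. As \<open>S / 20\<close> is at least 1,
      rounding down loses at most a factor 2.\<close>
    define s where "s = nat \<lfloor>S / 20\<rfloor>"
    have yw: "400 \<le> y / w" "9 \<le> w" "10 \<le> y" using t by (simp_all add: y_def w_def)
    have S2: "S ^ 2 = y / w" unfolding S_def using yw(1) by simp
    have S20: "20 \<le> S" unfolding S_def using yw(1) by (intro real_le_rsqrt) simp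
    have "real s = of_int \<lfloor>S / 20\<rfloor>" unfolding s_def using S20 by simp
    then have s_le: "real s \<le> S / 20" and s_ge: "S / 20 - 1 \<le> real s" by linarith+
    have s1: "1 \<le> s" unfolding s_def using S20 by (simp add: le_nat_iff le_floor_iff)
    have "S / 40 \<le> s"
    proof (cases "S \<le> 40")
      case True
      then show ?thesis using s1 by simp
    qed (use s_ge in simp)
    have s2: "real s ^ 2 \<le> y / w / 400"
    proof -
      have "real s ^ 2 \<le> (S / 20) ^ 2" by (rule power_mono[OF s_le]) simp
      then show ?thesis by (simp add: power_divide S2)
    qed
    have "real s ^ 2 \<le> y"
    proof -
      have "y / w / 400 \<le> y" using yw by (simp add: divide_le_eq)
      then show ?thesis using s2 by linarith
    qed
    then have "real s ^ 2 \<le> exp (w / 2) ^ 2"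
      using yw(3) by (simp add: w_def flip: exp_double)
    then have s_exp: "real s \<le> exp (w / 2)" by (rule power2_le_imp_le) simp
    \<comment> \<open>\<open>w \<ge> 9\<close> lets \<open>exp w\<close> absorb the 500, and the
      three factors \<open>s \<le> exp (w / 2)\<close> supply the remaining \<open>3 w / 2\<close>
      of the exponent.\<close>
    have "(500::real) \<le> 2 ^ 9" by simp
    also have "\<dots> \<le> exp 1 ^ 9" by (rule power_mono) (use exp_ge_add_one_self[of 1] in simp_all)
    also have "\<dots> = exp 9" by (simp flip: exp_of_nat_mult)
    also have "\<dots> \<le> exp w" using yw by simp
    finally have "500 * real s ^ 3 \<le> exp w * exp (w / 2) ^ 3"
      by (intro mult_mono power_mono s_exp) auto
    also have "\<dots> = exp (5 / 2 * w)" by (simp flip: exp_of_nat_mult exp_add)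
    finally have K: "500 * real s ^ 3 \<le> exp (5 / 2 * w)" .
    have "real ((500 * s ^ 3) ^ (50 * s ^ 2)) = (500 * real s ^ 3) ^ (50 * s ^ 2)" by simp
    also have "\<dots> \<le> exp (5 / 2 * w) ^ (50 * s ^ 2)" by (rule power_mono[OF K]) simp
    also have "\<dots> = exp (125 * (w * real s ^ 2))" by (simp flip: exp_of_nat_mult add: mult_ac)
    also have "\<dots> \<le> exp (y / 2)"
    proof -
      have "w * real s ^ 2 \<le> w * (y / w / 400)" using s2 yw by (intro mult_left_mono) auto
      also have "\<dots> = y / 400" using yw by simp
      finally show ?thesis using yw by simp
    qed
    finally have P: "real ((500 * s ^ 3) ^ (50 * s ^ 2)) \<le> exp (y / 2)" .
    \<comment> \<open>The other factor \<open>exp (y / 2)\<close> pays for the 20: 10 from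
      \<open>many_runs\<close>, times 2 because only half of the touching pairs are kept.\<close>
    have "(20::real) \<le> 2 ^ 5" by simp
    also have "\<dots> \<le> exp 1 ^ 5" by (rule power_mono) (use exp_ge_add_one_self[of 1] in simp_all)
    also have "\<dots> = exp 5" by (simp flip: exp_of_nat_mult)
    also have "\<dots> \<le> exp (y / 2)" using yw by simp
    finally have "20 * real ((500 * s ^ 3) ^ (50 * s ^ 2)) \<le> exp (y / 2) * exp (y / 2)"
      using P by (intro mult_mono) auto
    also have "\<dots> = t" using t(4) by (simp add: y_def flip: exp_add)
    finally have "20 * real ((500 * s ^ 3) ^ (50 * s ^ 2)) \<le> t" .
    then show "\<exists>s::nat. 1 \<le> s \<and> sqrt (ln t / ln (ln t)) / 40 \<le> s \<and>
        20 * real ((500 * s ^ 3) ^ (50 * s ^ 2)) \<le> t"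
      using s1 \<open>S / 40 \<le> s\<close> unfolding S_def y_def w_def by blast
  qed simp
qed

theorem theorem3:
  "\<exists>C > (0::real). \<exists>c > (0::real).
     \<forall>(S1 :: (real \<times> real) set set) (S2 :: (real \<times> real) set set) (n :: nat) (t :: real).
       finite S1 \<and> finite S2 \<and>
       (\<forall>s \<in> S1 \<union> S2. bi_infinite_x_monotone_curve s) \<and>
       general_position (S1 \<union> S2) \<and>
       card S1 = n \<and> card S2 = n \<and>
       real (card (touching_pairs S1 S2)) = t * real n \<and>
       t > C \<longrightarrow>
         real (card (crossing_points S1)) \<ge> c * (real n * t * sqrt (ln t / ln (ln t))) \<or>
         real (card (crossing_points S2)) \<ge> c * (real n * t * sqrt (ln t / ln (ln t)))"
proof -
  obtain C where C: "C > 0" "\<forall>t>C. \<exists>s::nat. 1 \<le> s \<and> sqrt (ln t / ln (ln t)) / 40 \<le> s \<and>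
     20 * real ((500 * s ^ 3) ^ (50 * s ^ 2)) \<le> t"
    using parameter_choice by blast
  \<comment> \<open>The constant is \<open>40 * 2 * 2\<close>: \<open>s\<close> is at least
    \<open>\<sigma> / 40\<close>, one orientation keeps half of the touching pairs, and one family
    has half of the crossing points.\<close>
  have main: "1 / 160 * (real n * t * sqrt (ln t / ln (ln t))) \<le> real (card (crossing_points S1)) \<or>
      1 / 160 * (real n * t * sqrt (ln t / ln (ln t))) \<le> real (card (crossing_points S2))"
    if fin: "finite S1" "finite S2" and c: "\<And>s. s \<in> S1 \<union> S2 \<Longrightarrow> bi_infinite_x_monotone_curve s"
      and gp: "general_position (S1 \<union> S2)" and n: "card S1 = n" "card S2 = n"
      and tp: "real (card (touching_pairs S1 S2)) = t * real n" and t: "t > C"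
    for S1 S2 :: "(real \<times> real) set set" and n :: nat and t :: real
  proof (cases "n = 0")
    case False
    define \<sigma> where "\<sigma> = sqrt (ln t / ln (ln t))"
    obtain s :: nat where s: "1 \<le> s" "\<sigma> / 40 \<le> s" "20 * real ((500 * s ^ 3) ^ (50 * s ^ 2)) \<le> t"
      using C(2) t unfolding \<sigma>_def by blast
    have tn: "0 < t * real n" using t C(1) False by simp
    have half: "\<sigma> / 80 * (real n * t)
        \<le> real (card (crossing_points F)) + real (card (crossing_points G))"
      if fin: "finite F" "finite G" and cd: "card F = n" "card G = n"
        and c: "\<And>s. s \<in> F \<union> G \<Longrightarrow> bi_infinite_x_monotone_curve s"
        and gp: "general_position (F \<union> G)"
        and E: "t * real n / 2 \<le> real (card (below_pairs F G))"
      for F G :: "(real \<times> real) set set"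
    proof -
      have "real (10 * n * (500 * s ^ 3) ^ (50 * s ^ 2))
          = real n / 2 * (20 * real ((500 * s ^ 3) ^ (50 * s ^ 2)))" by simp
      also have "\<dots> \<le> real n / 2 * t" by (rule mult_left_mono[OF s(3)]) simp
      also have "\<dots> \<le> real (card (below_pairs F G))" using E by (simp add: mult.commute)
      finally have large: "10 * n * (500 * s ^ 3) ^ (50 * s ^ 2) \<le> card (below_pairs F G)"
        by (simp only: of_nat_le_iff)
      have ne: "below_pairs F G \<noteq> {}" using E tn by auto
      have "s * card (below_pairs F G) \<le> card (crossing_points F) + card (crossing_points G)"
        by (rule crossing_points_lower_bound[OF fin _ _ c gp s(1) ne large]) (simp_all add: cd)
      then have "real s * real (card (below_pairs F G))
          \<le> real (card (crossing_points F)) + real (card (crossing_points G))"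
        by (simp only: of_nat_mult[symmetric] of_nat_add[symmetric] of_nat_le_iff)
      moreover have "\<sigma> / 40 * (t * real n / 2) \<le> real s * real (card (below_pairs F G))"
        by (rule mult_mono[OF s(2) E]) (use tn in auto)
      ultimately show ?thesis by (simp add: mult_ac)
    qed
    have "\<sigma> / 80 * (real n * t)
        \<le> real (card (crossing_points S1)) + real (card (crossing_points S2))"
    proof -
      have fE: "finite (below_pairs S1 S2)" "finite (below_pairs S2 S1)"
        by (auto intro: finite_subset[of _ "S1 \<times> S2"] finite_subset[of _ "S2 \<times> S1"]
            simp: below_pairs_def fin)
      have "card (touching_pairs S1 S2) \<le> card (below_pairs S1 S2 \<union> (below_pairs S2 S1)\<inverse>)"
        by (rule card_mono[OF _ touching_pairs_subset[OF c]]) (simp_all add: fE)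
      also have "\<dots> \<le> card (below_pairs S1 S2) + card (below_pairs S2 S1)"
        using card_Un_le[of "below_pairs S1 S2" "(below_pairs S2 S1)\<inverse>"] by simp
      finally have "t * real n \<le> real (card (below_pairs S1 S2)) + real (card (below_pairs S2 S1))"
        unfolding tp[symmetric] by linarith
      then consider "t * real n / 2 \<le> real (card (below_pairs S1 S2))"
        | "t * real n / 2 \<le> real (card (below_pairs S2 S1))" by linarith
      then show ?thesis
      proof cases
        case 1
        show ?thesis by (rule half[OF fin n c gp 1])
      next
        case 2
        have "\<sigma> / 80 * (real n * t)
            \<le> real (card (crossing_points S2)) + real (card (crossing_points S1))"
          by (rule half[OF fin(2,1) n(2,1) _ _ 2]) (use c gp in \<open>auto simp: Un_commute\<close>)
        then show ?thesis by simp
      qed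
    qed
    then show ?thesis unfolding \<sigma>_def[symmetric] by (simp add: mult_ac) linarith
  qed simp
  show ?thesis
    by (rule exI[of _ C], intro conjI C(1), rule exI[of _ "1 / 160"])
      (use main in auto)
qed

end
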